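(* Let $d\ge 1$ be an integer and let $W:\Omega\to \mathscr{D}'(\mathbb{T}^d)$ be a Gaussian white noise. Then: (1) For all $p\in [1,\infty)$ one has $\mathbb{P}\big(W\in B^{-d/2}_{p,\infty}(\mathbb{T}^d)\big)=1$. (2) For all $p\in[2,\infty)$ there exists a constant $c_{p,d}>0$ such that $\mathbb{P}\big(\|W\|_{B^{-d/2}_{p,\infty}(\mathbb{T}^d)}\ge c_{p,d}\big)=1$. (3) For any $p,q\in[1,\infty]$ and $s<-d/2$ one has $\mathbb{P}\big(W\in B^{s}_{p,q}(\mathbb{T}^d)\big)=1$. (4) For any $p\in[1,\infty]$ and $q\in[1,\infty)$ one has $\mathbb{P}\big(W\in B^{-d/2}_{p,q}(\mathbb{T}^d)\big)=0$. (5) For any $p,q\in[1,\infty]$ and $s>-d/2$ one has $\mathbb{P}\big(W\in B^{s}_{p,q}(\mathbb{T}^d)\big)=0$. (6) One has $\mathbb{P}\big(W\in B^{-d/2}_{\infty,\infty}(\mathbb{T}^d)\big)=0$.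
   Context: $(\Omega,\mathscr{A},\mathbb{P})$ is a probability space. $\mathbb{T}^d=[-\pi,\pi]^d$ is the $d$-dimensional torus (functions on it are $2\pi$-periodic in each variable) with Lebesgue measure $dx$; $L^p(\mathbb{T}^d)$ and $(f,g)_{L^2(\mathbb{T}^d)}=\int_{\mathbb{T}^d} f\overline{g}\,dx$ are taken with respect to $dx$. $\mathscr{D}(\mathbb{T}^d)$ is the space of complex-valued infinitely differentiable functions on $\mathbb{T}^d$ with the seminorms $\|f\|_\alpha=\sup_x|D^\alpha f(x)|$, $\alpha$ a multi-index, and $\mathscr{D}'(\mathbb{T}^d)$ is its dual, with bilinear pairing $\langle f,g\rangle$ for $f\in\mathscr{D}(\mathbb{T}^d)$, $g\in\mathscr{D}'(\mathbb{T}^d)$, extending $\int fg\,dx$. Fourier coefficients are $\hat f(k)=(2\pi)^{-d}\int_{\mathbb{T}^d} f(x)e^{-ik\cdot x}\,dx$ for functions and $\hat g(k)=(2\pi)^{-d}\langle e^{-ik\cdot x},g\rangle$ for $g\in \mathscr{D}'(\mathbb{T}^d)$, $k\in\mathbb{Z}^d$. A complex standard Gaussian random variable is $\gamma=(\gamma_{1}+i\gamma_{2})/\sqrt2$ with $\gamma_1,\gamma_2$ independent real standard Gaussian random variables. A complex Gaussian random variable is a centered $\gamma\in L^2(\Omega)$ such that $\gamma/(\mathbb{E}|\gamma|^2)^{1/2}$ is complex standard Gaussian (the zero random variable is included). A Gaussian white noise is a random variable $W:\Omega\to\mathscr{D}'(\mathbb{T}^d)$ (that is, $\langle f,W\rangle$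 is a random variable for all $f\in\mathscr{D}(\mathbb{T}^d)$) such that (i) for each $f\in\mathscr{D}(\mathbb{T}^d)$, $\langle f,W\rangle$ is a complex Gaussian random variable; (ii) $\mathbb{E}(\langle f,W\rangle\overline{\langle g,W\rangle})=(f,g)_{L^2(\mathbb{T}^d)}$ for all $f,g\in\mathscr{D}(\mathbb{T}^d)$. Besov spaces: fix a nonnegative $\phi\in C^\infty(\mathbb{R}^d)$ with support in $\{t:\tfrac12\le|t|\le2\}$ and $\sum_{j\in\mathbb{Z}}\phi(2^{-j}t)=1$ for $t\ne0$. Put $\varphi_j(t)=\phi(2^{-j}t)$ for $j\ge1$ and $\varphi_0=1-\sum_{k\ge1}\varphi_k$. For $f\in\mathscr{D}'(\mathbb{T}^d)$ let $f_j(x)=\sum_{k\in\mathbb{Z}^d}\varphi_j(k)\hat f(k)e^{ik\cdot x}$, $j\ge0$ (a finite sum). For $s\in\mathbb{R}$ and $p,q\in[1,\infty]$ let $\|f\|_{B^s_{p,q}(\mathbb{T}^d)}=\big(\sum_{j\ge0}2^{sjq}\|f_j\|_{L^p(\mathbb{T}^d)}^q\big)^{1/q}$ if $q<\infty$ and $\|f\|_{B^s_{p,\infty}(\mathbb{T}^d)}=\sup_{j\ge0}2^{sj}\|f_j\|_{L^p(\mathbb{T}^d)}$. $B^s_{p,q}(\mathbb{T}^d)$ is the space of all $f\in\mathscr{D}'(\mathbb{T}^d)$ with $\|f\|_{B^s_{p,q}(\mathbb{T}^d)}<\infty$. When $W(\omega)\notin B^s_{p,q}(\mathbb{T}^d)$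 the norm is $+\infty$. *)

theory Defs
  imports "HOL-Probability.Probability"
begin

text \<open>
  The torus is the cube \<open>[-\<pi>, \<pi>]\<close> to the power \<open>d\<close> inside \<^typ>\<open>real ^ 'd\<close>, with \<open>d = CARD('d)\<close>
  (automatically at least 1); functions on it are functions on the whole space that are
  \<open>2\<pi>\<close>-periodic in each variable.
\<close>

definition torus :: "(real ^ 'd::finite) set" where
  "torus = cbox (\<chi> i. - pi) (\<chi> i. pi)"

definition periodic_2pi :: "(real ^ 'd::finite \<Rightarrow> 'b) \<Rightarrow> bool" where
  "periodic_2pi f \<longleftrightarrow> (\<forall>x i. f (x + (2 * pi) *\<^sub>R axis i 1) = f x)"


section \<open>Smooth functions, test functions and distributions\<close>

definition partial_deriv ::
    "'d::finite \<Rightarrow> (real ^ 'd \<Rightarrow> 'b::real_normed_vector) \<Rightarrow> real ^ 'd \<Rightarrow> 'b" where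
  "partial_deriv i f = (\<lambda>x. frechet_derivative f (at x) (axis i 1))"

text \<open>
  Multi-indices are represented by lists of coordinate directions, so that the derivative along
  \<open>\<alpha>\<close> is the iterated partial derivative along a list in which \<open>i\<close> occurs \<open>\<alpha> i\<close> times. For smooth
  functions the order of the entries does not matter.
\<close>

fun multi_deriv ::
    "'d::finite list \<Rightarrow> (real ^ 'd \<Rightarrow> 'b::real_normed_vector) \<Rightarrow> real ^ 'd \<Rightarrow> 'b" where
  "multi_deriv [] f = f"
| "multi_deriv (i # \<alpha>) f = partial_deriv i (multi_deriv \<alpha> f)"

text \<open>Differentiability of every iterated partial derivative also gives their continuity.\<close>

definition smooth :: "(real ^ 'd::finite \<Rightarrow> 'b::real_normed_vector) \<Rightarrow> bool" where
  "smooth f \<longleftrightarrow> (\<forall>\<alpha> x. multi_deriv \<alpha> f differentiable (at x))"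

definition test_functions :: "(real ^ 'd::finite \<Rightarrow> complex) set" where
  "test_functions = {f. smooth f \<and> periodic_2pi f}"

definition test_seminorm :: "'d::finite list \<Rightarrow> (real ^ 'd \<Rightarrow> complex) \<Rightarrow> real" where
  "test_seminorm \<alpha> f = (SUP x. norm (multi_deriv \<alpha> f x))"

text \<open>The locally convex topology defined by the seminorms: the open balls of all seminorms form
  a subbase.\<close>

definition test_topology :: "(real ^ 'd::finite \<Rightarrow> complex) topology" where
  "test_topology = topology_generated_by
     {{g \<in> test_functions. test_seminorm \<alpha> (\<lambda>x. g x - f x) < e} |\<alpha> f e.
        f \<in> test_functions \<and> 0 < e}"

text \<open>
  The pairing of a test function \<open>f\<close> with a distribution \<open>u\<close> is the value \<open>u f\<close>. Only the values
  on test functions are relevant; the values elsewhere are not constrained and never used.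
\<close>

definition distributions :: "((real ^ 'd::finite \<Rightarrow> complex) \<Rightarrow> complex) set" where
  "distributions = {u.
     (\<forall>f\<in>test_functions. \<forall>g\<in>test_functions. u (\<lambda>x. f x + g x) = u f + u g) \<and>
     (\<forall>f\<in>test_functions. \<forall>c. u (\<lambda>x. c * f x) = c * u f) \<and>
     continuous_map test_topology euclidean u}"

definition torus_inner ::
    "(real ^ 'd::finite \<Rightarrow> complex) \<Rightarrow> (real ^ 'd \<Rightarrow> complex) \<Rightarrow> complex" where
  "torus_inner f g = (LINT x:torus|lborel. f x * cnj (g x))"

definition freq :: "int ^ 'd::finite \<Rightarrow> real ^ 'd" where
  "freq k = (\<chi> i. real_of_int (k $ i))"

definition fourier_coeff ::
    "((real ^ 'd::finite \<Rightarrow> complex) \<Rightarrow> complex) \<Rightarrow> int ^ 'd \<Rightarrow> complex" where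
  "fourier_coeff u k =
     complex_of_real (1 / (2 * pi) ^ CARD('d)) * u (\<lambda>x. exp (- \<i> * complex_of_real (freq k \<bullet> x)))"


section \<open>Gaussian white noise\<close>

definition std_complex_gaussian :: "'w measure \<Rightarrow> ('w \<Rightarrow> complex) \<Rightarrow> bool" where
  "std_complex_gaussian M X \<longleftrightarrow>
     (\<exists>g1 g2. distributed M lborel g1 std_normal_density \<and>
              distributed M lborel g2 std_normal_density \<and>
              prob_space.indep_var M borel g1 borel g2 \<and>
              (\<forall>\<omega>\<in>space M. X \<omega> = (complex_of_real (g1 \<omega>) + \<i> * complex_of_real (g2 \<omega>))
                                    / complex_of_real (sqrt 2)))"

definition complex_gaussian :: "'w measure \<Rightarrow> ('w \<Rightarrow> complex) \<Rightarrow> bool" where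
  "complex_gaussian M X \<longleftrightarrow>
     X \<in> borel_measurable M \<and>
     integrable M (\<lambda>\<omega>. (norm (X \<omega>))\<^sup>2) \<and>
     (LINT \<omega>|M. X \<omega>) = 0 \<and>
     ((AE \<omega> in M. X \<omega> = 0) \<or>
      std_complex_gaussian M
        (\<lambda>\<omega>. X \<omega> / complex_of_real (sqrt (LINT \<omega>'|M. (norm (X \<omega>'))\<^sup>2))))"

definition white_noise ::
    "'w measure \<Rightarrow> ('w \<Rightarrow> (real ^ 'd::finite \<Rightarrow> complex) \<Rightarrow> complex) \<Rightarrow> bool" where
  "white_noise M W \<longleftrightarrow>
     prob_space M \<and>
     (\<forall>\<omega>\<in>space M. W \<omega> \<in> distributions) \<and>
     (\<forall>f\<in>test_functions. (\<lambda>\<omega>. W \<omega> f) \<in> borel_measurable M) \<and>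
     (\<forall>f\<in>test_functions. complex_gaussian M (\<lambda>\<omega>. W \<omega> f)) \<and>
     (\<forall>f\<in>test_functions. \<forall>g\<in>test_functions.
        (LINT \<omega>|M. W \<omega> f * cnj (W \<omega> g)) = torus_inner f g)"

text \<open>The measurability conjunct is needed because \<^const>\<open>measure\<close> is 0 on non-measurable sets.\<close>

definition has_prob :: "'w measure \<Rightarrow> ('w \<Rightarrow> bool) \<Rightarrow> real \<Rightarrow> bool" where
  "has_prob M P r \<longleftrightarrow>
     {\<omega> \<in> space M. P \<omega>} \<in> sets M \<and> measure M {\<omega> \<in> space M. P \<omega>} = r"


section \<open>Besov spaces\<close>

text \<open>Real powers on the extended half-line, used for positive exponents only.\<close>

definition ennpowr :: "ennreal \<Rightarrow> real \<Rightarrow> ennreal" where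
  "ennpowr x a = (if x = \<infinity> then \<infinity> else ennreal (enn2real x powr a))"

definition Lp_norm :: "ennreal \<Rightarrow> (real ^ 'd::finite \<Rightarrow> complex) \<Rightarrow> ennreal" where
  "Lp_norm p f =
     (if p = \<infinity> then esssup (restrict_space lborel torus) (\<lambda>x. ennreal (norm (f x)))
      else ennpowr (\<integral>\<^sup>+ x. ennreal (norm (f x) powr enn2real p) \<partial>restrict_space lborel torus)
             (1 / enn2real p))"

definition dyadic_partition :: "(real ^ 'd::finite \<Rightarrow> real) \<Rightarrow> bool" where
  "dyadic_partition \<phi> \<longleftrightarrow>
     smooth \<phi> \<and>
     (\<forall>t. 0 \<le> \<phi> t) \<and>
     closure {t. \<phi> t \<noteq> 0} \<subseteq> {t. 1 / 2 \<le> norm t \<and> norm t \<le> 2} \<and>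
     (\<forall>t. t \<noteq> 0 \<longrightarrow> ((\<lambda>j::int. \<phi> ((2 powi (- j)) *\<^sub>R t)) has_sum 1) UNIV)"

definition lp_cutoff :: "(real ^ 'd::finite \<Rightarrow> real) \<Rightarrow> nat \<Rightarrow> real ^ 'd \<Rightarrow> real" where
  "lp_cutoff \<phi> j t =
     (if j = 0 then 1 - (\<Sum>k. \<phi> (((1 / 2) ^ Suc k) *\<^sub>R t)) else \<phi> (((1 / 2) ^ j) *\<^sub>R t))"

text \<open>The sum runs over the frequencies where the cutoff does not vanish; there are only finitely
  many of them.\<close>

definition lp_block ::
    "(real ^ 'd::finite \<Rightarrow> real) \<Rightarrow> nat \<Rightarrow> ((real ^ 'd \<Rightarrow> complex) \<Rightarrow> complex) \<Rightarrow> real ^ 'd \<Rightarrow> complex"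
  where
  "lp_block \<phi> j u x =
     (\<Sum>k | lp_cutoff \<phi> j (freq k) \<noteq> 0.
        complex_of_real (lp_cutoff \<phi> j (freq k)) * fourier_coeff u k
          * exp (\<i> * complex_of_real (freq k \<bullet> x)))"

definition besov_norm ::
    "(real ^ 'd::finite \<Rightarrow> real) \<Rightarrow> real \<Rightarrow> ennreal \<Rightarrow> ennreal
       \<Rightarrow> ((real ^ 'd \<Rightarrow> complex) \<Rightarrow> complex) \<Rightarrow> ennreal" where
  "besov_norm \<phi> s p q u =
     (if q = \<infinity> then (SUP j. ennreal (2 powr (s * real j)) * Lp_norm p (lp_block \<phi> j u))
      else ennpowr
        (\<Sum>j. ennreal (2 powr (s * real j * enn2real q))
               * ennpowr (Lp_norm p (lp_block \<phi> j u)) (enn2real q))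
        (1 / enn2real q))"

definition besov ::
    "(real ^ 'd::finite \<Rightarrow> real) \<Rightarrow> real \<Rightarrow> ennreal \<Rightarrow> ennreal
       \<Rightarrow> ((real ^ 'd \<Rightarrow> complex) \<Rightarrow> complex) set" where
  "besov \<phi> s p q = {u \<in> distributions. besov_norm \<phi> s p q u < \<infinity>}"

end

theory Submission
  imports Defs "HOL-Real_Asymp.Real_Asymp"
begin

text \<open>
  At a point \<open>x\<close> the block \<open>f\<^sub>j\<close> of white noise is a finite linear combination of the values of the
  noise on characters. It is therefore a centered complex Gaussian variable. Its variance
  \<open>\<sigma>\<^sub>j\<^sup>2\<close> does not depend on \<open>x\<close>, and it is comparable to \<open>2\<close> to the power \<open>j d\<close>, the number of
  lattice points in the dyadic annulus of index \<open>j\<close>. All six claims follow from one limit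
  (\<open>lp_block_moment_tendsto\<close>): almost surely, for every \<open>m\<close>, the integral of
  \<open>\<bar>f\<^sub>j / \<sigma>\<^sub>j\<bar>\<close> to the power \<open>2 m\<close> over the torus tends to \<open>(2 \<pi>)\<close> to the power \<open>d\<close>, times \<open>m!\<close>.

  The limit is the expectation of the integral, by the formula for the moments of a complex
  Gaussian variable (\<open>complex_gaussian_moment\<close>). The variance of the integral is a double integral
  of covariances. The covariance of the powers \<open>2 m\<close> of two normalized jointly Gaussian variables
  is at most a constant times the squared modulus of their correlation
  (\<open>two_point_moment_bound\<close>), and by Parseval the double integral of the latter is of the order of
  \<open>1 / \<sigma>\<^sub>j\<^sup>2\<close> (\<open>noise_series_variance_bound\<close>). This is summable in \<open>j\<close>, so that the squared
  deviations from the limit are almost surely summable.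

  What remains is a deterministic statement about a distribution whose normalized blocks have these
  limiting moments (\<open>typical_blocks\<close>).

  \<^item> For finite \<open>p\<close> the norm of \<open>f\<^sub>j\<close> in \<open>L\<^sup>p\<close> is of the exact order of \<open>\<sigma>\<^sub>j\<close>. It is at most of this
    order because \<open>t\<close> to the power \<open>p\<close> is at most \<open>1\<close> plus an even power of \<open>t\<close>. It is at least of
    this order because the second and the fourth moment together prevent \<open>\<bar>f\<^sub>j\<bar>\<close> from being
    concentrated on a small set. At smoothness \<open>- d / 2\<close> the block sequence is
    thus bounded and eventually bounded away from \<open>0\<close>, which decides the critical case for finite
    \<open>p\<close> and gives the divergence above the critical smoothness.

  \<^item> The sup norm divided by \<open>\<sigma>\<^sub>j\<close> dominates, in the limit, the root of order \<open>2 m\<close> of \<open>m!\<close>, for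
    every \<open>m\<close>. These roots are unbounded, so the critical norm with \<open>p = q = \<infinity>\<close> is infinite, and
    the divergence for the other parameters extends to \<open>p = \<infinity>\<close>.

  \<^item> The Nikolskii inequality for trigonometric polynomials (\<open>nikolskii_bound\<close>) bounds the sup norm
    by the norm in \<open>L\<close> with exponent \<open>2 m\<close> at the cost of the factor \<open>2\<close> to the power
    \<open>j d / (2 m)\<close>. As \<open>m\<close> is arbitrary, this is a loss of arbitrarily little smoothness, which is
    harmless when \<open>s < - d / 2\<close>.
\<close>


section \<open>Absolute moments of complex Gaussian variables\<close>

text \<open>
  These are the Taylor coefficients of \<open>1 / sqrt (1 + x)\<close>. They enter because the even moments of a
  real Gaussian variable are, up to elementary factors, central binomial coefficients.
\<close>

lemma gbinomial_minus_half:
  "((-1/2) :: real) gchoose k = (-1/4) ^ k * (fact (2 * k) / (fact k)\<^sup>2)"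
proof (induction k)
  case 0
  then show ?case by simp
next
  case (Suc k)
  have "((-1/2) :: real) gchoose Suc k = ((-1/2) gchoose k) * ((-1/2) - real k) / (real k + 1)"
    by (simp add: gbinomial_prod_rev field_simps)
  also have "\<dots> = (-1/4) ^ k * (fact (2 * k) / (fact k)\<^sup>2) * ((-1/2) - real k) / (real k + 1)"
    by (simp only: Suc.IH)
  also have "\<dots> = (-1/4) ^ Suc k * (fact (2 * Suc k) / (fact (Suc k))\<^sup>2)"
  proof -
    have "(fact (2 * Suc k) :: real) = (2 * real k + 2) * (2 * real k + 1) * fact (2 * k)"
      by (simp add: algebra_simps)
    moreover have "(fact (Suc k) :: real) = (real k + 1) * fact k" by simp
    moreover have "real k + 1 \<noteq> 0" by linarith
    moreover have "(fact k :: real) \<noteq> 0" by simp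
    ultimately show ?thesis
      by (simp add: divide_simps power2_eq_square del: fact_Suc) (simp add: algebra_simps)
  qed
  finally show ?case .
qed

text \<open>
  The square of the series of \<open>1 / sqrt (1 + x)\<close> is the geometric series; in terms of coefficients
  this is the Vandermonde identity with both parameters equal to \<open>-1/2\<close>.
\<close>

lemma central_binomial_convolution:
  "(\<Sum>k\<le>n. (fact (2 * k) / (fact k)\<^sup>2) * (fact (2 * (n - k)) / (fact (n - k))\<^sup>2)) = (4::real) ^ n"
proof -
  let ?h = "\<lambda>k. fact (2 * k) / (fact k)\<^sup>2 :: real"
  have "(-1/4) ^ n * (\<Sum>k\<le>n. ?h k * ?h (n - k))
      = (\<Sum>k=0..n. (((-1/2)::real) gchoose k) * ((-1/2) gchoose (n - k)))"
    unfolding sum_distrib_left gbinomial_minus_half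
  proof (rule sum.cong)
    fix k assume "k \<in> {0..n}"
    then have "((-1/4)::real) ^ n = (-1/4) ^ k * (-1/4) ^ (n - k)"
      by (simp flip: power_add)
    then show "(-1/4) ^ n * (?h k * ?h (n - k)) = (-1/4) ^ k * ?h k * ((-1/4) ^ (n - k) * ?h (n - k))"
      by simp
  qed auto
  also have "\<dots> = (-1::real) gchoose n"
    by (subst gbinomial_Vandermonde) simp
  also have "\<dots> = (-1) ^ n"
    using gbinomial_minus[of "1::real" n] by (simp flip: binomial_gbinomial add: binomial_n_n)
  finally have eq: "(-1/4) ^ n * (\<Sum>k\<le>n. ?h k * ?h (n - k)) = (-1) ^ n" .
  have "(\<Sum>k\<le>n. ?h k * ?h (n - k)) = (-4)^n * ((-1/4) ^ n * (\<Sum>k\<le>n. ?h k * ?h (n - k)))"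
    by (simp flip: power_mult_distrib mult.assoc)
  also have "\<dots> = 4 ^ n" unfolding eq by (simp flip: power_mult_distrib)
  finally show ?thesis .
qed

text \<open>
  The squared modulus is half the sum of the squares of two independent real Gaussian variables. The
  binomial theorem turns its moments into a convolution of real moments, which is the preceding sum.
\<close>

lemma std_complex_gaussian_moment:
  assumes "prob_space M" "std_complex_gaussian M X"
  shows "has_bochner_integral M (\<lambda>\<omega>. norm (X \<omega>) ^ (2 * n)) (fact n)"
proof -
  interpret prob_space M by fact
  obtain g1 g2 where D: "distributed M lborel g1 std_normal_density"
      "distributed M lborel g2 std_normal_density"
    and ind: "indep_var borel g1 borel g2"
    and X: "\<And>\<omega>. \<omega> \<in> space M \<Longrightarrow>
      X \<omega> = (complex_of_real (g1 \<omega>) + \<i> * complex_of_real (g2 \<omega>)) / complex_of_real (sqrt 2)"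
    using assms(2) unfolding std_complex_gaussian_def by blast
  let ?\<mu> = "\<lambda>k. fact (2 * k) / (2 ^ k * fact k) :: real"
  have mom: "has_bochner_integral M (\<lambda>\<omega>. g \<omega> ^ (2 * k)) (?\<mu> k)"
    if "distributed M lborel g std_normal_density" for g k
  proof -
    have "integrable M (\<lambda>\<omega>. g \<omega> ^ (2 * k))"
      using distributed_integrable[OF that, of "\<lambda>x. x ^ (2 * k)"] integrable_std_normal_moment[of "2 * k"]
      by simp
    moreover have "(\<integral>\<omega>. g \<omega> ^ (2 * k) \<partial>M) = ?\<mu> k"
      using distributed_integral[OF that, of "\<lambda>x. x ^ (2 * k)"] integral_std_normal_moment_even[of k]
      by simp
    ultimately show ?thesis by (simp add: has_bochner_integral_iff)
  qed
  have prod: "has_bochner_integral M (\<lambda>\<omega>. g1 \<omega> ^ (2 * k) * g2 \<omega> ^ (2 * l)) (?\<mu> k * ?\<mu> l)" for k l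
  proof -
    have "indep_var borel (\<lambda>\<omega>. g1 \<omega> ^ (2 * k)) borel (\<lambda>\<omega>. g2 \<omega> ^ (2 * l))"
      using indep_var_compose[OF ind, of "\<lambda>x. x ^ (2 * k)" borel "\<lambda>x. x ^ (2 * l)" borel]
      by (simp add: comp_def)
    moreover have "integrable M (\<lambda>\<omega>. g1 \<omega> ^ (2 * k))" "integrable M (\<lambda>\<omega>. g2 \<omega> ^ (2 * l))"
      "(\<integral>\<omega>. g1 \<omega> ^ (2 * k) \<partial>M) = ?\<mu> k" "(\<integral>\<omega>. g2 \<omega> ^ (2 * l) \<partial>M) = ?\<mu> l"
      using mom[OF D(1), of k] mom[OF D(2), of l] by (simp_all only: has_bochner_integral_iff)
    ultimately show ?thesis
      by (simp only: has_bochner_integral_iff indep_var_integrable indep_var_lebesgue_integral)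
  qed
  have "has_bochner_integral M
      (\<lambda>\<omega>. \<Sum>k\<le>n. (real (n choose k) / 2 ^ n) * (g1 \<omega> ^ (2 * k) * g2 \<omega> ^ (2 * (n - k))))
      (\<Sum>k\<le>n. (real (n choose k) / 2 ^ n) * (?\<mu> k * ?\<mu> (n - k)))"
    by (intro has_bochner_integral_sum has_bochner_integral_mult_right prod)
  moreover have "(\<Sum>k\<le>n. (real (n choose k) / 2 ^ n) * (?\<mu> k * ?\<mu> (n - k))) = fact n"
  proof -
    have "(real (n choose k) / 2 ^ n) * (?\<mu> k * ?\<mu> (n - k))
        = (fact n / 4 ^ n) * ((fact (2 * k) / (fact k)\<^sup>2) * (fact (2 * (n - k)) / (fact (n - k))\<^sup>2))"
      if "k \<le> n" for k
    proof -
      have "(2::real) ^ k * 2 ^ (n - k) = 2 ^ n" using that by (simp flip: power_add)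
      then have "(2::real) ^ n * (2 ^ k * 2 ^ (n - k)) = 4 ^ n"
        by (simp flip: power_mult_distrib)
      then show ?thesis using that
        by (simp add: binomial_fact field_simps power2_eq_square)
    qed
    then have "(\<Sum>k\<le>n. (real (n choose k) / 2 ^ n) * (?\<mu> k * ?\<mu> (n - k)))
      = (\<Sum>k\<le>n. (fact n / 4 ^ n) * ((fact (2 * k) / (fact k)\<^sup>2) * (fact (2 * (n - k)) / (fact (n - k))\<^sup>2)))"
      by (intro sum.cong) auto
    also have "\<dots> = (fact n / 4 ^ n) * 4 ^ n"
      by (simp only: central_binomial_convolution flip: sum_distrib_left)
    finally show ?thesis by simp
  qed
  moreover have "norm (X \<omega>) ^ (2 * n)
      = (\<Sum>k\<le>n. (real (n choose k) / 2 ^ n) * (g1 \<omega> ^ (2 * k) * g2 \<omega> ^ (2 * (n - k))))"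
    if "\<omega> \<in> space M" for \<omega>
  proof -
    have "complex_of_real (g1 \<omega>) + \<i> * complex_of_real (g2 \<omega>) = Complex (g1 \<omega>) (g2 \<omega>)"
      by (simp add: complex_eq_iff)
    then have "(norm (X \<omega>))\<^sup>2 = ((g1 \<omega>)\<^sup>2 + (g2 \<omega>)\<^sup>2) / 2"
      by (simp add: X[OF that] norm_divide power_divide cmod_def)
    then have "norm (X \<omega>) ^ (2 * n) = (((g1 \<omega>)\<^sup>2 + (g2 \<omega>)\<^sup>2) / 2) ^ n"
      unfolding power_mult by (rule arg_cong)
    also have "\<dots> = (\<Sum>k\<le>n. (real (n choose k) / 2 ^ n) * (g1 \<omega> ^ (2 * k) * g2 \<omega> ^ (2 * (n - k))))"
      unfolding power_divide binomial_ring
      by (simp add: sum_divide_distrib mult_ac flip: power_mult)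
    finally show ?thesis .
  qed
  ultimately show ?thesis
    by (subst has_bochner_integral_cong[OF refl]) auto
qed

text \<open>
  The degenerate variable satisfies the formula too: for \<open>n = 0\<close> both sides are \<open>1\<close> because
  \<open>0 ^ 0 = 1\<close>. In the other case the variance cannot vanish, because the normalized variable would
  be \<open>0\<close> by the convention for division.
\<close>

lemma complex_gaussian_moment:
  assumes "prob_space M" "complex_gaussian M X"
  shows "has_bochner_integral M (\<lambda>\<omega>. norm (X \<omega>) ^ (2 * n)) (fact n * (LINT \<omega>|M. (norm (X \<omega>))\<^sup>2) ^ n)"
proof -
  interpret prob_space M by fact
  define v where "v = (LINT \<omega>|M. (norm (X \<omega>))\<^sup>2)"
  have [measurable]: "X \<in> borel_measurable M" using assms(2) by (simp add: complex_gaussian_def)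
  have "v \<ge> 0" unfolding v_def by simp
  consider "AE \<omega> in M. X \<omega> = 0"
    | "std_complex_gaussian M (\<lambda>\<omega>. X \<omega> / complex_of_real (sqrt v))"
    using assms(2) unfolding complex_gaussian_def v_def by blast
  then show ?thesis
  proof cases
    case 1
    then have "v = 0" unfolding v_def by (subst integral_eq_zero_AE) auto
    have "has_bochner_integral M (\<lambda>\<omega>. norm (X \<omega>) ^ (2 * n)) (fact n * v ^ n)
      \<longleftrightarrow> has_bochner_integral M (\<lambda>\<omega>. 0 ^ (2 * n)) (fact n * v ^ n)"
      by (rule has_bochner_integral_cong_AE) (use 1 in auto)
    also have \<dots>
      using \<open>v = 0\<close> by (cases "n = 0") (auto simp: has_bochner_integral_iff prob_space power_0_left)
    finally show ?thesis unfolding v_def .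
  next
    case 2
    have "v \<noteq> 0"
    proof
      assume "v = 0"
      then show False
        using std_complex_gaussian_moment[OF assms(1) 2, of 1] by (simp add: has_bochner_integral_iff)
    qed
    with \<open>v \<ge> 0\<close> have "v > 0" by simp
    have "has_bochner_integral M
        (\<lambda>\<omega>. v ^ n * norm (X \<omega> / complex_of_real (sqrt v)) ^ (2 * n)) (v ^ n * fact n)"
      by (intro has_bochner_integral_mult_right std_complex_gaussian_moment assms 2)
    moreover have "v ^ n * norm (X \<omega> / complex_of_real (sqrt v)) ^ (2 * n) = norm (X \<omega>) ^ (2 * n)" for \<omega>
      using \<open>v > 0\<close> by (simp add: norm_divide power_divide power_mult)
    ultimately show ?thesis by (simp add: v_def mult.commute)
  qed
qed

section \<open>Joint moments of two correlated Gaussian variables\<close>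

lemma complex_poly_eq_0_if_zero_on_reals:
  fixes p :: "complex poly"
  assumes "\<And>x::real. poly p (of_real x) = 0"
  shows "p = 0"
proof (rule ccontr)
  assume "p \<noteq> 0"
  then have "finite {x. poly p x = 0}" by (rule poly_roots_finite)
  moreover have "range complex_of_real \<subseteq> {x. poly p x = 0}" using assms by auto
  ultimately have "finite (range complex_of_real)" by (rule rev_finite_subset)
  then show False
    using infinite_UNIV_char_0 finite_imageD inj_of_real by blast
qed

text \<open>
  A polynomial in \<open>z\<close> and \<open>cnj z\<close> is a polynomial in the real and imaginary parts of \<open>z\<close>. It can be
  continued to complex values of these two, one after the other, and then \<open>z\<close> and \<open>cnj z\<close> become
  independent variables.
\<close>

lemma conj_polynomial_coeffs_eq_0:
  fixes A :: "nat \<Rightarrow> nat \<Rightarrow> complex"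
  assumes zero: "\<And>z. (\<Sum>i\<le>n. \<Sum>l\<le>n. A i l * z ^ i * cnj z ^ l) = 0" and "i \<le> n" "l \<le> n"
  shows "A i l = 0"
proof -
  define P where "P x y = (\<Sum>i\<le>n. \<Sum>l\<le>n. A i l * (x + \<i> * y) ^ i * (x - \<i> * y) ^ l)" for x y
  have P0: "P (of_real x) (of_real y) = 0" for x y :: real
    using zero[of "of_real x + \<i> * of_real y"] by (simp add: P_def)
  have P1: "P x (of_real y) = 0" for x and y :: real
  proof -
    define p where "p = (\<Sum>i\<le>n. \<Sum>l\<le>n. smult (A i l)
      ([:\<i> * of_real y, 1:] ^ i * [:- \<i> * of_real y, 1:] ^ l))"
    have p: "poly p x = P x (of_real y)" for x
      by (simp add: p_def P_def poly_sum mult.assoc add.commute)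
    then have "p = 0"
      using P0 by (intro complex_poly_eq_0_if_zero_on_reals) auto
    then show ?thesis using p[of x] by simp
  qed
  have P2: "P x y = 0" for x y
  proof -
    define p where "p = (\<Sum>i\<le>n. \<Sum>l\<le>n. smult (A i l) ([:x, \<i>:] ^ i * [:x, - \<i>:] ^ l))"
    have p: "poly p y = P x y" for y
      by (simp add: p_def P_def poly_sum mult.assoc mult.commute[of y])
    then have "p = 0"
      using P1 by (intro complex_poly_eq_0_if_zero_on_reals) auto
    then show ?thesis using p[of y] by simp
  qed
  have "(\<Sum>i\<le>n. (\<Sum>l\<le>n. A i l * w ^ l) * z ^ i) = 0" for z w
  proof -
    have "\<i> * (a * (- \<i>)) = a" for a by (simp add: complex_eq_iff)
    then have "(z + w) / 2 + \<i> * ((z - w) / 2 * (- \<i>)) = (z + w) / 2 + (z - w) / 2"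
      "(z + w) / 2 - \<i> * ((z - w) / 2 * (- \<i>)) = (z + w) / 2 - (z - w) / 2"
      by (simp_all only:)
    then have "(z + w) / 2 + \<i> * ((z - w) / 2 * (- \<i>)) = z" "(z + w) / 2 - \<i> * ((z - w) / 2 * (- \<i>)) = w"
      by (simp_all flip: add_divide_distrib diff_divide_distrib)
    with P2[of "(z + w) / 2" "(z - w) / 2 * (- \<i>)"] show ?thesis
      by (simp only: P_def sum_distrib_left mult_ac)
  qed
  then have "(\<Sum>l\<le>n. A i l * w ^ l) = 0" for w
    using zero_polynom_imp_zero_coeffs[of "\<lambda>i. \<Sum>l\<le>n. A i l * w ^ l" n] \<open>i \<le> n\<close> by blast
  then show ?thesis
    using zero_polynom_imp_zero_coeffs[of "A i" n] \<open>l \<le> n\<close> by blast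
qed

text \<open>
  The sum collects the binomial factors of all terms with a positive power of the correlation in the
  exact expression for the joint moment.
\<close>

definition two_point_const :: "nat \<Rightarrow> real" where
  "two_point_const m = fact (2 * m) / (real ((2 * m) choose m))\<^sup>2
     * (\<Sum>r<m. real ((2 * m) choose r) * (real ((2 * m - r) choose (m - r)))\<^sup>2)"

lemma two_point_const_nonneg: "0 \<le> two_point_const m"
  by (simp add: two_point_const_def sum_nonneg)

text \<open>
  The moment of order \<open>4 m\<close> of \<open>X + z Y\<close> is known for every complex \<open>z\<close>, because this variable is
  Gaussian. It is a polynomial in \<open>z\<close> and \<open>cnj z\<close> in which the joint moment appears, up to a
  binomial factor, as the coefficient of \<open>z ^ m * cnj z ^ m\<close>. Comparing coefficients writes the
  joint moment as a sum with one term of size at most \<open>(m!)\<^sup>2\<close>, while all other terms contain a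
  positive power of \<open>\<bar>\<alpha>\<bar>\<^sup>2\<close>. Moreover \<open>\<bar>\<alpha>\<bar> \<le> 1\<close>, since a variance is nonnegative.
\<close>

lemma two_point_moment_bound:
  fixes X Y :: "'w \<Rightarrow> complex"
  assumes M: "prob_space M" and Y: "complex_gaussian M Y"
    and XY: "\<And>z. complex_gaussian M (\<lambda>\<omega>. X \<omega> + z * Y \<omega>)"
    and cov: "\<And>z. (LINT \<omega>|M. (norm (X \<omega> + z * Y \<omega>))\<^sup>2) = 1 + (norm z)\<^sup>2 + 2 * Re (z * \<alpha>)"
  shows "integrable M (\<lambda>\<omega>. norm (X \<omega>) ^ (2 * m) * norm (Y \<omega>) ^ (2 * m))" (is ?int)
    and "(LINT \<omega>|M. norm (X \<omega>) ^ (2 * m) * norm (Y \<omega>) ^ (2 * m))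
           \<le> (fact m)\<^sup>2 + two_point_const m * (norm \<alpha>)\<^sup>2"
proof -
  interpret prob_space M by fact
  have X: "complex_gaussian M X" using XY[of 0] by simp
  have [measurable]: "X \<in> borel_measurable M" "Y \<in> borel_measurable M"
    using X Y by (simp_all add: complex_gaussian_def)
  define n where "n = 2 * m"
  define G where "G i \<omega> = of_nat (n choose i) * Y \<omega> ^ i * X \<omega> ^ (n - i)" for i \<omega>
  have G_meas [measurable]: "G i \<in> borel_measurable M" for i unfolding G_def by measurable
  have cnj_meas [measurable]: "cnj \<in> borel_measurable borel"
    by (intro borel_measurable_continuous_onI continuous_intros)
  have intn: "integrable M (\<lambda>\<omega>. norm (X \<omega>) ^ (2 * n) + norm (Y \<omega>) ^ (2 * n))"
    using complex_gaussian_moment[OF M X, of n] complex_gaussian_moment[OF M Y, of n]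
    by (simp add: has_bochner_integral_iff)
  have mixed: "norm (Y \<omega>) ^ k * norm (X \<omega>) ^ (2 * n - k) \<le> norm (X \<omega>) ^ (2 * n) + norm (Y \<omega>) ^ (2 * n)"
    if "k \<le> 2 * n" for k \<omega>
  proof -
    let ?t = "max (norm (X \<omega>)) (norm (Y \<omega>))"
    have "norm (Y \<omega>) ^ k * norm (X \<omega>) ^ (2 * n - k) \<le> ?t ^ k * ?t ^ (2 * n - k)"
      by (intro mult_mono power_mono) (auto simp: le_max_iff_disj)
    also have "\<dots> = ?t ^ (2 * n)" using that by (simp flip: power_add)
    also have "\<dots> \<le> norm (X \<omega>) ^ (2 * n) + norm (Y \<omega>) ^ (2 * n)"
      by (cases "norm (X \<omega>) \<le> norm (Y \<omega>)") (auto simp: max_def)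
    finally show ?thesis .
  qed
  have G_int: "integrable M (\<lambda>\<omega>. G i \<omega> * cnj (G l \<omega>))" if "i \<le> n" "l \<le> n" for i l
  proof (rule Bochner_Integration.integrable_bound)
    show "integrable M (\<lambda>\<omega>. real (n choose i) * real (n choose l)
        * (norm (X \<omega>) ^ (2 * n) + norm (Y \<omega>) ^ (2 * n)))"
      using intn by (rule integrable_mult_right)
    have "norm (G i \<omega> * cnj (G l \<omega>))
        \<le> real (n choose i) * real (n choose l) * (norm (X \<omega>) ^ (2 * n) + norm (Y \<omega>) ^ (2 * n))" for \<omega>
    proof -
      have "norm (X \<omega>) ^ (n - i) * norm (X \<omega>) ^ (n - l) = norm (X \<omega>) ^ (2 * n - (i + l))"
        using that by (simp add: mult_2 flip: power_add)
      then have "norm (G i \<omega> * cnj (G l \<omega>)) = real (n choose i) * real (n choose l)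
          * (norm (Y \<omega>) ^ (i + l) * norm (X \<omega>) ^ (2 * n - (i + l)))"
        by (simp add: G_def norm_mult norm_power power_add)
      also have "\<dots> \<le> real (n choose i) * real (n choose l) * (norm (X \<omega>) ^ (2 * n) + norm (Y \<omega>) ^ (2 * n))"
        using that by (intro mult_left_mono mixed) auto
      finally show ?thesis .
    qed
    also have "\<dots> \<omega> \<le> norm (real (n choose i) * real (n choose l)
        * (norm (X \<omega>) ^ (2 * n) + norm (Y \<omega>) ^ (2 * n)))" for \<omega> by simp
    finally show "AE \<omega> in M. norm (G i \<omega> * cnj (G l \<omega>))
        \<le> norm (real (n choose i) * real (n choose l) * (norm (X \<omega>) ^ (2 * n) + norm (Y \<omega>) ^ (2 * n)))"
      by simp
  qed measurable
  define A where "A i l = (LINT \<omega>|M. G i \<omega> * cnj (G l \<omega>))" for i l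
  \<comment> \<open>The moment of order \<open>2 n\<close> of \<open>X + z Y\<close>, expanded by the binomial theorem.\<close>
  have lhs: "complex_of_real (LINT \<omega>|M. norm (X \<omega> + z * Y \<omega>) ^ (2 * n))
      = (\<Sum>i\<le>n. \<Sum>l\<le>n. A i l * z ^ i * cnj z ^ l)" for z
  proof -
    have pt: "complex_of_real (norm (X \<omega> + z * Y \<omega>) ^ (2 * n))
        = (\<Sum>i\<le>n. \<Sum>l\<le>n. (G i \<omega> * cnj (G l \<omega>)) * (z ^ i * cnj z ^ l))" for \<omega>
    proof -
      have e: "(X \<omega> + z * Y \<omega>) ^ n = (\<Sum>i\<le>n. G i \<omega> * z ^ i)"
        unfolding G_def by (subst add.commute, subst binomial_ring) (simp add: power_mult_distrib mult_ac)
      have "complex_of_real (norm (X \<omega> + z * Y \<omega>) ^ (2 * n))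
          = (X \<omega> + z * Y \<omega>) ^ n * cnj ((X \<omega> + z * Y \<omega>) ^ n)"
        unfolding complex_norm_square[symmetric] by (simp add: norm_power flip: power_mult mult.commute)
      also have "\<dots> = (\<Sum>i\<le>n. \<Sum>l\<le>n. (G i \<omega> * cnj (G l \<omega>)) * (z ^ i * cnj z ^ l))"
        unfolding e cnj_sum sum_product by (simp add: mult_ac)
      finally show ?thesis .
    qed
    have "complex_of_real (LINT \<omega>|M. norm (X \<omega> + z * Y \<omega>) ^ (2 * n))
        = (LINT \<omega>|M. complex_of_real (norm (X \<omega> + z * Y \<omega>) ^ (2 * n)))"
      by (simp del: of_real_power)
    also have "\<dots> = (\<Sum>i\<le>n. \<Sum>l\<le>n. A i l * (z ^ i * cnj z ^ l))"
      unfolding pt A_def using G_int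
      by (subst Bochner_Integration.integral_sum, force,
          intro sum.cong refl, subst Bochner_Integration.integral_sum) auto
    finally show ?thesis by (simp add: mult.assoc)
  qed
  define c where "c r i = (if r \<le> i then of_nat ((n - r) choose (i - r)) * \<alpha> ^ (i - r) else 0)" for r i
  have c: "z ^ r * (1 + z * \<alpha>) ^ (n - r) = (\<Sum>i\<le>n. c r i * z ^ i)" if "r \<le> n" for r z
  proof -
    have "z ^ r * (1 + z * \<alpha>) ^ (n - r)
        = (\<Sum>k\<le>n - r. of_nat ((n - r) choose k) * \<alpha> ^ k * z ^ (k + r))"
      by (subst add.commute, subst binomial_ring)
        (simp add: sum_distrib_left power_mult_distrib power_add mult_ac)
    also have "\<dots> = (\<Sum>i\<in>{r..n}. of_nat ((n - r) choose (i - r)) * \<alpha> ^ (i - r) * z ^ i)"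
      using that by (intro sum.reindex_bij_witness[of _ "\<lambda>i. i - r" "\<lambda>k. k + r"]) auto
    also have "\<dots> = (\<Sum>i\<le>n. c r i * z ^ i)"
      unfolding c_def by (intro sum.mono_neutral_cong_left) auto
    finally show ?thesis .
  qed
  \<comment> \<open>The variance of \<open>X - cnj \<alpha> * Y\<close>.\<close>
  define \<beta> where "\<beta> = 1 - (norm \<alpha>)\<^sup>2"
  define B where "B i l = fact n * (\<Sum>r\<le>n. of_nat (n choose r) * of_real \<beta> ^ r * (c r i * cnj (c r l)))" for i l
  \<comment> \<open>The same moment from the Gaussian moment formula; the variance factors up to a term
    in \<open>z * cnj z\<close>, which makes the coefficients explicit.\<close>
  have rhs: "complex_of_real (LINT \<omega>|M. norm (X \<omega> + z * Y \<omega>) ^ (2 * n))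
      = (\<Sum>i\<le>n. \<Sum>l\<le>n. B i l * z ^ i * cnj z ^ l)" for z
  proof -
    let ?u = "1 + z * \<alpha>"
    have var: "complex_of_real (1 + (norm z)\<^sup>2 + 2 * Re (z * \<alpha>)) = (of_real \<beta> * (z * cnj z)) + ?u * cnj ?u"
      by (simp add: complex_eq_iff \<beta>_def cmod_power2) (simp add: algebra_simps power2_eq_square)
    have summand: "of_nat (n choose r) * (of_real \<beta> * (z * cnj z)) ^ r * (?u * cnj ?u) ^ (n - r)
        = (\<Sum>i\<le>n. \<Sum>l\<le>n. of_nat (n choose r) * of_real \<beta> ^ r * (c r i * cnj (c r l)) * (z ^ i * cnj z ^ l))"
      if "r \<le> n" for r
    proof -
      have "of_nat (n choose r) * (of_real \<beta> * (z * cnj z)) ^ r * (?u * cnj ?u) ^ (n - r)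
        = of_nat (n choose r) * of_real \<beta> ^ r * ((z ^ r * ?u ^ (n - r)) * cnj (z ^ r * ?u ^ (n - r)))"
        by (simp add: power_mult_distrib mult_ac)
      also have "\<dots> = (\<Sum>i\<le>n. \<Sum>l\<le>n. of_nat (n choose r) * of_real \<beta> ^ r * (c r i * cnj (c r l)) * (z ^ i * cnj z ^ l))"
        unfolding c[OF that] cnj_sum sum_product by (simp add: sum_distrib_left mult_ac)
      finally show ?thesis .
    qed
    have "complex_of_real (LINT \<omega>|M. norm (X \<omega> + z * Y \<omega>) ^ (2 * n))
        = fact n * ((of_real \<beta> * (z * cnj z)) + ?u * cnj ?u) ^ n"
      unfolding var[symmetric] has_bochner_integral_integral_eq[OF complex_gaussian_moment[OF M XY[of z], of n]]
        cov by (simp only: of_real_mult of_real_power of_real_fact)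
    also have "\<dots> = fact n * (\<Sum>r\<le>n. \<Sum>i\<le>n. \<Sum>l\<le>n. of_nat (n choose r) * of_real \<beta> ^ r
        * (c r i * cnj (c r l)) * (z ^ i * cnj z ^ l))"
      unfolding binomial_ring by (intro arg_cong2[where f = "(*)"] sum.cong refl summand) auto
    also have "\<dots> = fact n * (\<Sum>i\<le>n. \<Sum>l\<le>n. \<Sum>r\<le>n. of_nat (n choose r) * of_real \<beta> ^ r
        * (c r i * cnj (c r l)) * (z ^ i * cnj z ^ l))"
      by (subst sum.swap, subst (2) sum.swap) (rule refl)
    also have "\<dots> = (\<Sum>i\<le>n. \<Sum>l\<le>n. B i l * z ^ i * cnj z ^ l)"
      by (simp add: B_def sum_distrib_left sum_distrib_right mult_ac)
    finally show ?thesis .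
  qed
  have "A m m - B m m = 0"
  proof (rule conj_polynomial_coeffs_eq_0[where n = n and A = "\<lambda>i l. A i l - B i l"])
    show "(\<Sum>i\<le>n. \<Sum>l\<le>n. (A i l - B i l) * z ^ i * cnj z ^ l) = 0" for z
      using lhs[of z] rhs[of z] by (simp add: left_diff_distrib sum_subtractf)
  qed (auto simp: n_def)
  then have AB: "A m m = B m m" by simp
  let ?E = "LINT \<omega>|M. norm (X \<omega>) ^ (2 * m) * norm (Y \<omega>) ^ (2 * m)"
  let ?b = "real (n choose m)"
  have b: "?b > 0" by (simp add: n_def)
  have GG: "G m \<omega> * cnj (G m \<omega>) = complex_of_real (?b\<^sup>2 * (norm (X \<omega>) ^ (2 * m) * norm (Y \<omega>) ^ (2 * m)))" for \<omega>
    unfolding complex_norm_square[symmetric]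
    by (simp add: G_def n_def norm_mult norm_power power_mult_distrib power_mult mult_ac
        flip: power_mult)
  have "integrable M (\<lambda>\<omega>. ?b\<^sup>2 * (norm (X \<omega>) ^ (2 * m) * norm (Y \<omega>) ^ (2 * m)))"
    using G_int[of m m] unfolding GG complex_of_real_integrable_eq by (simp add: n_def)
  then show ?int using b by simp
  have A: "A m m = complex_of_real (?b\<^sup>2 * ?E)"
    unfolding A_def GG integral_complex_of_real by (simp only: Bochner_Integration.integral_mult_right_zero)
  let ?d = "\<lambda>r. real (n choose r) * \<beta> ^ r * ((real ((n - r) choose (m - r)))\<^sup>2 * norm \<alpha> ^ (2 * (m - r)))"
  have B: "B m m = complex_of_real (fact n * (\<Sum>r\<le>m. ?d r))"
  proof -
    have "(\<Sum>r\<le>n. of_nat (n choose r) * of_real \<beta> ^ r * (c r m * cnj (c r m)))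
        = (\<Sum>r\<le>m. complex_of_real (?d r))"
    proof (rule sum.mono_neutral_cong_right)
      fix r assume "r \<in> {..m}"
      then have "c r m * cnj (c r m)
          = complex_of_real ((real ((n - r) choose (m - r)))\<^sup>2 * norm \<alpha> ^ (2 * (m - r)))"
        unfolding complex_norm_square[symmetric]
        by (simp add: c_def norm_mult norm_power power_mult_distrib mult.commute[of 2] flip: power_mult)
      then show "of_nat (n choose r) * of_real \<beta> ^ r * (c r m * cnj (c r m)) = complex_of_real (?d r)"
        by simp
    qed (auto simp: c_def n_def)
    then show ?thesis by (simp add: B_def)
  qed
  have "?b\<^sup>2 * ?E = fact n * (\<Sum>r\<le>m. ?d r)"
    using AB unfolding A B by (simp only: of_real_eq_iff)
  moreover have "(\<Sum>r\<le>m. ?d r) \<le> ?b + (\<Sum>r<m. real (n choose r) * (real ((n - r) choose (m - r)))\<^sup>2) * (norm \<alpha>)\<^sup>2"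
  proof -
    have "0 \<le> (LINT \<omega>|M. (norm (X \<omega> + (- cnj \<alpha>) * Y \<omega>))\<^sup>2)" by simp
    also have "\<dots> = \<beta>"
      unfolding cov \<beta>_def by (simp add: cmod_power2 flip: power2_eq_square)
    finally have "0 \<le> \<beta>" .
    then have a1: "(norm \<alpha>)\<^sup>2 \<le> 1" unfolding \<beta>_def by simp
    have "\<beta> \<le> 1" unfolding \<beta>_def by simp
    have le1: "?d r \<le> real (n choose r) * (real ((n - r) choose (m - r)))\<^sup>2 * (norm \<alpha>)\<^sup>2" if "r < m" for r
    proof -
      have "m - r = Suc (m - r - 1)" using that by simp
      then have "norm \<alpha> ^ (2 * (m - r)) = (norm \<alpha>)\<^sup>2 * ((norm \<alpha>)\<^sup>2) ^ (m - r - 1)"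
        by (metis power_Suc power_mult)
      also have "\<dots> \<le> (norm \<alpha>)\<^sup>2 * 1"
        using a1 by (intro mult_left_mono power_le_one[of "(norm \<alpha>)\<^sup>2"]) auto
      finally have p: "norm \<alpha> ^ (2 * (m - r)) \<le> (norm \<alpha>)\<^sup>2" by simp
      have "?d r \<le> real (n choose r) * 1 * ((real ((n - r) choose (m - r)))\<^sup>2 * (norm \<alpha>)\<^sup>2)"
        using \<open>0 \<le> \<beta>\<close> \<open>\<beta> \<le> 1\<close> p by (intro mult_mono power_le_one mult_left_mono) auto
      then show ?thesis by (simp add: mult_ac)
    qed
    have "(\<Sum>r\<le>m. ?d r) = ?d m + (\<Sum>r<m. ?d r)"
      by (simp add: lessThan_Suc_atMost[symmetric])
    also have "?d m \<le> ?b"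
      using power_le_one[OF \<open>0 \<le> \<beta>\<close> \<open>\<beta> \<le> 1\<close>, of m] b by simp
    also have "(\<Sum>r<m. ?d r) \<le> (\<Sum>r<m. real (n choose r) * (real ((n - r) choose (m - r)))\<^sup>2 * (norm \<alpha>)\<^sup>2)"
      using le1 by (intro sum_mono) auto
    finally show ?thesis by (simp add: sum_distrib_right)
  qed
  ultimately have "?b\<^sup>2 * ?E \<le> fact n * (?b + (\<Sum>r<m. real (n choose r) * (real ((n - r) choose (m - r)))\<^sup>2) * (norm \<alpha>)\<^sup>2)"
    by (simp add: mult_left_mono)
  then have "?E \<le> fact n * (?b + (\<Sum>r<m. real (n choose r) * (real ((n - r) choose (m - r)))\<^sup>2) * (norm \<alpha>)\<^sup>2) / ?b\<^sup>2"
    using b by (simp add: pos_le_divide_eq mult.commute)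
  also have "\<dots> = fact n / ?b + two_point_const m * (norm \<alpha>)\<^sup>2"
    using b by (simp add: two_point_const_def n_def field_simps power2_eq_square)
  also have "fact n / ?b = (fact m)\<^sup>2"
    by (simp add: n_def binomial_fact power2_eq_square)
  finally show "?E \<le> (fact m)\<^sup>2 + two_point_const m * (norm \<alpha>)\<^sup>2" .
qed

section \<open>Characters of the torus\<close>

definition character :: "int ^ 'd::finite \<Rightarrow> real ^ 'd \<Rightarrow> complex" where
  "character k x = exp (\<i> * complex_of_real (freq k \<bullet> x))"

lemma freq_add: "freq (k + l) = freq k + freq l"
  by (simp add: freq_def vec_eq_iff)

lemma freq_uminus: "freq (- k) = - freq k"
  by (simp add: freq_def vec_eq_iff)

lemma freq_inner_axis: "freq k \<bullet> axis i 1 = real_of_int (k $ i)"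
  by (simp add: inner_axis freq_def)

lemma character_0 [simp]: "character 0 x = 1"
  by (simp add: character_def freq_def inner_vec_def)

lemma character_add: "character (k + l) x = character k x * character l x"
  by (simp add: character_def freq_add inner_add_left distrib_left exp_add)

lemma character_uminus: "character (- k) x = cnj (character k x)"
  by (simp add: character_def freq_uminus exp_cnj)

lemma norm_character [simp]: "norm (character k x) = 1"
  by (simp add: character_def norm_exp_eq_Re)

lemma continuous_on_character [continuous_intros]: "continuous_on S (character k)"
  unfolding character_def[abs_def] by (intro continuous_intros)

lemma borel_measurable_character [measurable]: "character k \<in> borel_measurable borel"
  by (intro borel_measurable_continuous_onI continuous_intros)

lemma character_shift: "character k (x + (2 * pi) *\<^sub>R axis i 1) = character k x"
proof -
  have "freq k \<bullet> (x + (2 * pi) *\<^sub>R axis i 1) = freq k \<bullet> x + 2 * pi * real_of_int (k $ i)"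
    by (simp add: inner_add_right freq_inner_axis)
  then have "character k (x + (2 * pi) *\<^sub>R axis i 1)
      = character k x * exp (\<i> * complex_of_real (2 * pi * real_of_int (k $ i)))"
    by (simp add: character_def distrib_left exp_add)
  moreover have "exp (\<i> * complex_of_real (2 * pi * real_of_int (k $ i))) = 1"
    using exp_integer_2pi[of "of_int (k $ i)"] by (simp add: mult_ac)
  ultimately show ?thesis by simp
qed

lemma has_derivative_trig_poly:
  "((\<lambda>x. \<Sum>k\<in>K. c k * character k x) has_derivative
     (\<lambda>h. \<Sum>k\<in>K. c k * (\<i> * complex_of_real (freq k \<bullet> h) * character k x))) (at x)"
proof (rule has_derivative_sum)
  fix k assume "k \<in> K"
  have "((\<lambda>x. complex_of_real (freq k \<bullet> x)) has_derivative (\<lambda>h. complex_of_real (freq k \<bullet> h))) (at x)"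
    by (intro has_derivative_of_real has_derivative_inner_right has_derivative_ident)
  then have "((\<lambda>x. \<i> * complex_of_real (freq k \<bullet> x)) has_derivative (\<lambda>h. \<i> * complex_of_real (freq k \<bullet> h))) (at x)"
    by (rule has_derivative_mult_right)
  from has_derivative_compose[OF this DERIV_exp[unfolded has_field_derivative_def]]
  have "(character k has_derivative (\<lambda>h. \<i> * complex_of_real (freq k \<bullet> h) * character k x)) (at x)"
    unfolding character_def[abs_def] by (simp add: mult_ac)
  then show "((\<lambda>x. c k * character k x) has_derivative
      (\<lambda>h. c k * (\<i> * complex_of_real (freq k \<bullet> h) * character k x))) (at x)"
    by (rule has_derivative_mult_right)
qed

text \<open>
  The derivatives are again trigonometric polynomials, so that smoothness of all of them reduces to
  differentiability of one.
\<close>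

lemma multi_deriv_trig_poly:
  "multi_deriv \<alpha> (\<lambda>x. \<Sum>k\<in>K. c k * character k x)
     = (\<lambda>x. \<Sum>k\<in>K. (c k * (\<Prod>i\<leftarrow>\<alpha>. \<i> * of_int (k $ i))) * character k x)"
proof (induction \<alpha>)
  case Nil
  then show ?case by simp
next
  case (Cons i \<alpha>)
  let ?c = "\<lambda>k. c k * (\<Prod>i\<leftarrow>\<alpha>. \<i> * of_int (k $ i))"
  have "frechet_derivative (\<lambda>x. \<Sum>k\<in>K. ?c k * character k x) (at x)
      = (\<lambda>h. \<Sum>k\<in>K. ?c k * (\<i> * complex_of_real (freq k \<bullet> h) * character k x))" for x
    by (rule frechet_derivative_at[symmetric]) (rule has_derivative_trig_poly)
  then show ?case
    unfolding multi_deriv.simps Cons.IH partial_deriv_def by (simp add: freq_inner_axis mult_ac)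
qed

lemma trig_poly_test_function:
  "(\<lambda>x. \<Sum>k\<in>K. c k * character k x) \<in> test_functions"
proof -
  have "smooth (\<lambda>x. \<Sum>k\<in>K. c k * character k x)"
    unfolding smooth_def multi_deriv_trig_poly differentiable_def
    by (intro allI exI) (rule has_derivative_trig_poly)
  moreover have "periodic_2pi (\<lambda>x. \<Sum>k\<in>K. c k * character k x)"
    by (simp add: periodic_2pi_def character_shift)
  ultimately show ?thesis by (simp add: test_functions_def)
qed

lemma character_test_function: "(\<lambda>x. c * character k x) \<in> test_functions"
  using trig_poly_test_function[of "\<lambda>_. c" "{k}"] by simp

lemma character_in_test_functions: "character k \<in> test_functions"
  using character_test_function[of 1 k] by simp

lemma distribution_scale:
  "u \<in> distributions \<Longrightarrow> f \<in> test_functions \<Longrightarrow> u (\<lambda>x. c * f x) = c * u f"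
  by (simp add: distributions_def)

lemma distribution_add:
  "u \<in> distributions \<Longrightarrow> f \<in> test_functions \<Longrightarrow> g \<in> test_functions \<Longrightarrow>
     u (\<lambda>x. f x + g x) = u f + u g"
  by (simp add: distributions_def)

lemma distribution_trig_poly:
  assumes "u \<in> distributions" "finite K"
  shows "u (\<lambda>x. \<Sum>k\<in>K. c k * character k x) = (\<Sum>k\<in>K. c k * u (character k))"
  using assms(2)
proof (induction K)
  case empty
  have "u (\<lambda>x. 0 * character 0 x) = 0 * u (character 0)"
    by (rule distribution_scale[OF assms(1) character_in_test_functions])
  then show ?case by simp
next
  case (insert l K)
  have "u (\<lambda>x. c l * character l x + (\<Sum>k\<in>K. c k * character k x))
      = u (\<lambda>x. c l * character l x) + u (\<lambda>x. \<Sum>k\<in>K. c k * character k x)"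
    by (intro distribution_add assms(1) character_test_function trig_poly_test_function)
  moreover have "u (\<lambda>x. c l * character l x) = c l * u (character l)"
    by (rule distribution_scale[OF assms(1) character_in_test_functions])
  ultimately show ?case using insert by simp
qed

abbreviation torus_measure :: "(real ^ 'd::finite) measure" where
  "torus_measure \<equiv> restrict_space lborel torus"

lemma sets_torus [measurable]: "torus \<in> sets borel"
  by (simp add: torus_def)

lemma space_torus_measure [simp]: "space torus_measure = torus"
  by (simp add: space_restrict_space)

lemma inner_const_vec_Basis:
  "b \<in> Basis \<Longrightarrow> ((\<chi> i. c) :: real ^ 'd::finite) \<bullet> b = c"
  by (auto simp: Basis_vec_def inner_axis)

lemma emeasure_torus: "emeasure torus_measure (torus :: (real ^ 'd::finite) set) = ennreal ((2 * pi) ^ CARD('d))"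
proof -
  have "emeasure lborel (torus :: (real ^ 'd) set) = ennreal (\<Prod>b\<in>(Basis :: (real ^ 'd) set). 2 * pi)"
    unfolding torus_def
    by (subst emeasure_lborel_cbox) (auto simp: inner_const_vec_Basis inner_diff_left intro!: arg_cong[where f = ennreal] prod.cong)
  then show ?thesis by (subst emeasure_restrict_space) auto
qed

lemma finite_torus_measure: "finite_measure (torus_measure :: (real ^ 'd::finite) measure)"
  by (rule finite_measureI) (simp add: emeasure_torus)

lemma measure_torus: "measure torus_measure (torus :: (real ^ 'd::finite) set) = (2 * pi) ^ CARD('d)"
  by (simp add: measure_def emeasure_torus)

lemma integrable_torus_continuous:
  fixes f :: "real ^ 'd::finite \<Rightarrow> 'b::{banach, second_countable_topology}"
  assumes "continuous_on UNIV f"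
  shows "integrable torus_measure f"
proof -
  have "integrable lborel (\<lambda>x. indicator torus x *\<^sub>R f x)"
    unfolding torus_def using assms
    by (intro borel_integrable_compact continuous_on_subset[OF assms]) auto
  then show ?thesis
    by (subst integrable_restrict_space) auto
qed

lemma integral_exp_2pi_periodic:
  "(LINT t|lborel. indicator {-pi..pi} t *\<^sub>R exp (\<i> * complex_of_real (of_int n * t)))
     = (if n = 0 then 2 * pi else 0)"
proof (cases "n = 0")
  case True
  then show ?thesis by (simp add: scaleR_conv_of_real)
next
  case False
  let ?F = "\<lambda>t::real. exp (\<i> * complex_of_real (of_int n * t)) / (\<i> * of_int n)"
  have "(LINT t|lborel. indicator {-pi..pi} t *\<^sub>R exp (\<i> * complex_of_real (of_int n * t))) = ?F pi - ?F (- pi)"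
  proof (rule integral_FTC_atLeastAtMost)
    fix t :: real
    have "((\<lambda>z. exp (\<i> * (of_int n * z)) / (\<i> * of_int n)) has_field_derivative exp (\<i> * (of_int n * of_real t)))
        (at (complex_of_real t))"
      using False by (auto intro!: derivative_eq_intros simp: mult_ac)
    from has_vector_derivative_real_field[OF this, of "{-pi..pi}"]
    show "(?F has_vector_derivative exp (\<i> * complex_of_real (of_int n * t))) (at t within {-pi..pi})"
      by simp
  qed (auto intro!: continuous_intros)
  also have "?F (- pi) = ?F pi * exp (- (2 * of_int n * complex_of_real pi * \<i>))"
    by (simp add: algebra_simps flip: exp_add)
  also have "exp (- (2 * of_int n * complex_of_real pi * \<i>)) = 1"
    using exp_integer_2pi[of "of_int (- n)"] by (simp add: mult_ac)
  finally show ?thesis using False by simp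
qed

text \<open>
  Lebesgue measure is a product measure over the coordinates, and a character is a product of
  characters of one variable; one factor vanishes as soon as one frequency is nonzero.
\<close>

lemma integral_character:
  "(LINT x|torus_measure. character k x) = (if k = 0 then (2 * pi) ^ CARD('d) else 0)"
  for k :: "int ^ 'd::finite"
proof -
  let ?B = "Basis :: (real ^ 'd) set"
  let ?h = "\<lambda>b t. indicator {-pi..pi} t *\<^sub>R exp (\<i> * complex_of_real ((freq k \<bullet> b) * t))"
  interpret product_sigma_finite "\<lambda>b::real^'d. lborel :: real measure" by standard
  have pt: "indicator torus x *\<^sub>R character k x = (\<Prod>b\<in>?B. ?h b (x \<bullet> b))" for x :: "real ^ 'd"
  proof -
    have "indicator torus x = (\<Prod>b\<in>?B. indicator {-pi..pi} (x \<bullet> b) :: real)"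
      by (auto simp: torus_def mem_box inner_const_vec_Basis indicator_def prod_zero_iff)
    moreover have "character k x = (\<Prod>b\<in>?B. exp (\<i> * complex_of_real ((freq k \<bullet> b) * (x \<bullet> b))))"
      unfolding character_def euclidean_inner[of "freq k" x]
      by (simp add: sum_distrib_left exp_sum del: of_real_mult)
    ultimately show ?thesis by (simp add: scaleR_conv_of_real prod.distrib)
  qed
  have freq_int: "\<exists>n. freq k \<bullet> b = real_of_int n" if "b \<in> ?B" for b
    using that by (auto simp: Basis_vec_def freq_inner_axis)
  have h_int: "integrable lborel (?h b)" for b
    by (intro borel_integrable_compact continuous_intros) auto
  have "(LINT x|torus_measure. character k x) = (LINT x|lborel. indicator torus x *\<^sub>R character k x)"
    by (subst integral_restrict_space) auto
  also have "\<dots> = (LINT f|(\<Pi>\<^sub>M b\<in>?B. lborel). (\<Prod>b\<in>?B. ?h b ((\<Sum>a\<in>?B. f a *\<^sub>R a) \<bullet> b)))"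
    unfolding pt by (subst lborel_eq, subst integral_distr) auto
  also have "\<dots> = (LINT f|(\<Pi>\<^sub>M b\<in>?B. lborel). (\<Prod>b\<in>?B. ?h b (f b)))"
    by (intro Bochner_Integration.integral_cong prod.cong) (auto simp: inner_sum_left_Basis)
  also have "\<dots> = (\<Prod>b\<in>?B. LINT t|lborel. ?h b t)"
    by (intro product_integral_prod h_int) auto
  also have "\<dots> = (\<Prod>b\<in>?B. complex_of_real (if freq k \<bullet> b = 0 then 2 * pi else 0))"
  proof (rule prod.cong)
    fix b assume "b \<in> ?B"
    then obtain n where "freq k \<bullet> b = real_of_int n" using freq_int by blast
    then show "(LINT t|lborel. ?h b t) = complex_of_real (if freq k \<bullet> b = 0 then 2 * pi else 0)"
      using integral_exp_2pi_periodic[of n] by simp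
  qed simp
  also have "\<dots> = (if k = 0 then (2 * pi) ^ CARD('d) else 0)"
  proof (cases "k = 0")
    case True
    then show ?thesis by (simp add: freq_def inner_const_vec_Basis)
  next
    case False
    then obtain i where "k $ i \<noteq> 0" by (auto simp: vec_eq_iff)
    then have "freq k \<bullet> axis i 1 \<noteq> 0" by (simp add: freq_inner_axis)
    moreover have "axis i 1 \<in> ?B" by (auto simp: Basis_vec_def)
    ultimately show ?thesis using False by (auto simp: prod_zero_iff)
  qed
  finally show ?thesis .
qed

section \<open>Trigonometric polynomials and the Nikolskii inequality\<close>

lemma trig_poly_inner:
  fixes K :: "(int ^ 'd::finite) set"
  assumes "finite K"
  shows "(LINT x|torus_measure. (\<Sum>k\<in>K. c k * character k x) * cnj (\<Sum>k\<in>K. d k * character k x))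
    = (2 * pi) ^ CARD('d) * (\<Sum>k\<in>K. c k * cnj (d k))"
proof -
  have "(\<Sum>k\<in>K. c k * character k x) * cnj (\<Sum>k\<in>K. d k * character k x)
      = (\<Sum>k\<in>K. \<Sum>l\<in>K. (c k * cnj (d l)) * character (k - l) x)" for x
    unfolding cnj_sum sum_product
    using character_add[of _ "- l" x for l] by (simp add: character_uminus mult_ac)
  then have "(LINT x|torus_measure. (\<Sum>k\<in>K. c k * character k x) * cnj (\<Sum>k\<in>K. d k * character k x))
      = (LINT x|torus_measure. (\<Sum>k\<in>K. \<Sum>l\<in>K. (c k * cnj (d l)) * character (k - l) x))"
    by simp
  also have "\<dots> = (\<Sum>k\<in>K. \<Sum>l\<in>K. (c k * cnj (d l)) * (LINT x|torus_measure. character (k - l) x))"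
    by (subst Bochner_Integration.integral_sum, intro integrable_torus_continuous continuous_intros,
        intro sum.cong refl, subst Bochner_Integration.integral_sum,
        intro integrable_torus_continuous continuous_intros, simp)
  also have "\<dots> = (\<Sum>k\<in>K. \<Sum>l\<in>K. if k = l then c k * cnj (d k) * (2 * pi) ^ CARD('d) else 0)"
    by (intro sum.cong refl) (auto simp: integral_character)
  also have "\<dots> = (2 * pi) ^ CARD('d) * (\<Sum>k\<in>K. c k * cnj (d k))"
    using assms by (simp add: sum_distrib_left mult_ac)
  finally show ?thesis .
qed

lemma trig_poly_parseval:
  fixes K :: "(int ^ 'd::finite) set"
  assumes "finite K"
  shows "(LINT x|torus_measure. (norm (\<Sum>k\<in>K. c k * character k x))\<^sup>2)
    = (2 * pi) ^ CARD('d) * (\<Sum>k\<in>K. (norm (c k))\<^sup>2)"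
proof -
  have "complex_of_real (LINT x|torus_measure. (norm (\<Sum>k\<in>K. c k * character k x))\<^sup>2)
      = (LINT x|torus_measure. complex_of_real ((norm (\<Sum>k\<in>K. c k * character k x))\<^sup>2))"
    by (simp del: of_real_power)
  also have "\<dots> = complex_of_real ((2 * pi) ^ CARD('d) * (\<Sum>k\<in>K. (norm (c k))\<^sup>2))"
    unfolding complex_norm_square using trig_poly_inner[OF assms, of c c]
    by (simp add: complex_norm_square del: of_real_power)
  finally show ?thesis by (simp only: of_real_eq_iff)
qed

text \<open>
  Used for the upper bound on the number of frequencies of a block and for the lower bound on the
  number of those where the cutoff is large.
\<close>

lemma card_lattice_box:
  fixes A :: "'d::finite \<Rightarrow> int set"
  assumes "\<And>i. finite (A i)"
  shows "finite {k :: int ^ 'd. \<forall>i. k $ i \<in> A i}"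
    and "card {k :: int ^ 'd. \<forall>i. k $ i \<in> A i} = (\<Prod>i\<in>UNIV. card (A i))"
proof -
  have bij: "bij_betw vec_lambda (Pi\<^sub>E UNIV A) {k :: int ^ 'd. \<forall>i. k $ i \<in> A i}"
    by (rule bij_betw_byWitness[of _ vec_nth]) auto
  have fin: "finite (Pi\<^sub>E (UNIV :: 'd set) A)" using assms by (intro finite_PiE) auto
  show "finite {k :: int ^ 'd. \<forall>i. k $ i \<in> A i}"
    using bij_betw_finite[OF bij] fin by simp
  show "card {k :: int ^ 'd. \<forall>i. k $ i \<in> A i} = (\<Prod>i\<in>UNIV. card (A i))"
    using bij_betw_same_card[OF bij] by (simp add: card_PiE)
qed

definition lattice_cube :: "nat \<Rightarrow> (int ^ 'd::finite) set" where
  "lattice_cube N = {k. \<forall>i. \<bar>k $ i\<bar> \<le> int N}"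

lemma lattice_cube:
  shows finite_lattice_cube: "finite (lattice_cube N :: (int ^ 'd::finite) set)"
    and card_lattice_cube: "card (lattice_cube N :: (int ^ 'd::finite) set) = (2 * N + 1) ^ CARD('d)"
proof -
  have "lattice_cube N = {k :: int ^ 'd. \<forall>i. k $ i \<in> {- int N..int N}}"
    by (auto simp: lattice_cube_def abs_le_iff minus_le_iff)
  moreover have c: "card {- int N..int N} = 2 * N + 1" by simp
  ultimately show "finite (lattice_cube N :: (int ^ 'd) set)"
    and "card (lattice_cube N :: (int ^ 'd) set) = (2 * N + 1) ^ CARD('d)"
    using card_lattice_box[of "\<lambda>_::'d. {- int N..int N}"] c
    by (simp_all del: card_atLeastAtMost_int atLeastAtMost_iff)
qed

definition trig_polys :: "nat \<Rightarrow> (real ^ 'd::finite \<Rightarrow> complex) set" where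
  "trig_polys N = {f. \<exists>c. f = (\<lambda>x. \<Sum>k\<in>lattice_cube N. c k * character k x)}"

lemma trig_polysI: "(\<And>x. f x = (\<Sum>k\<in>lattice_cube N. c k * character k x)) \<Longrightarrow> f \<in> trig_polys N"
  unfolding trig_polys_def by blast

lemma trig_polys_scaled_character:
  assumes "k \<in> lattice_cube N"
  shows "(\<lambda>x. a * character k x) \<in> trig_polys N"
proof (rule trig_polysI)
  show "a * character k x = (\<Sum>l\<in>lattice_cube N. (if l = k then a else 0) * character l x)" for x
    using assms by (simp add: if_distrib[of "\<lambda>c. c * _"] finite_lattice_cube cong: if_cong)
qed

lemma trig_polys_const: "(\<lambda>_. a) \<in> trig_polys N"
  using trig_polys_scaled_character[of 0 N a] by (simp add: lattice_cube_def)

lemma trig_polys_add: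
  assumes "f \<in> trig_polys N" "g \<in> trig_polys N"
  shows "(\<lambda>x. f x + g x) \<in> trig_polys N"
proof -
  obtain c d where "f = (\<lambda>x. \<Sum>k\<in>lattice_cube N. c k * character k x)"
      "g = (\<lambda>x. \<Sum>k\<in>lattice_cube N. d k * character k x)"
    using assms unfolding trig_polys_def by blast
  then show ?thesis
    by (intro trig_polysI[where c = "\<lambda>k. c k + d k"]) (simp add: distrib_right sum.distrib)
qed

lemma trig_polys_sum:
  assumes "\<And>i. i \<in> I \<Longrightarrow> f i \<in> trig_polys N"
  shows "(\<lambda>x. \<Sum>i\<in>I. f i x) \<in> trig_polys N"
  using assms
proof (induction I rule: infinite_finite_induct)
  case (insert i I)
  then show ?case by (simp add: trig_polys_add)
next
  case empty
  show ?case by (simp add: trig_polys_const)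
next
  case (infinite I)
  then show ?case by (simp add: trig_polys_const)
qed

text \<open>
  Degrees add up under multiplication; this is what makes powers accessible in the Nikolskii
  inequality.
\<close>

lemma trig_polys_mult:
  assumes "f \<in> trig_polys N" "g \<in> trig_polys N'"
  shows "(\<lambda>x. f x * g x) \<in> trig_polys (N + N')"
proof -
  obtain c d where fg: "f = (\<lambda>x. \<Sum>k\<in>lattice_cube N. c k * character k x)"
      "g = (\<lambda>x. \<Sum>k\<in>lattice_cube N'. d k * character k x)"
    using assms unfolding trig_polys_def by blast
  have eq: "(\<lambda>x. f x * g x)
      = (\<lambda>x. \<Sum>k\<in>lattice_cube N. \<Sum>l\<in>lattice_cube N'. (c k * d l) * character (k + l) x)"
    unfolding fg sum_product by (simp add: character_add mult_ac)
  have "\<bar>a + b\<bar> \<le> int N + int N'" if "\<bar>a\<bar> \<le> int N" "\<bar>b\<bar> \<le> int N'" for a b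
    using that by linarith
  then show ?thesis
    unfolding eq
    by (intro trig_polys_sum trig_polys_scaled_character) (auto simp: lattice_cube_def)
qed

lemma trig_polys_power:
  assumes "f \<in> trig_polys N"
  shows "(\<lambda>x. f x ^ m) \<in> trig_polys (m * N)"
proof (induction m)
  case 0
  show ?case by (simp add: trig_polys_const)
next
  case (Suc m)
  from trig_polys_mult[OF assms this] show ?case by simp
qed

text \<open>
  The sum of the moduli of the coefficients is bounded by Cauchy-Schwarz, at the cost of the square
  root of the number of frequencies.
\<close>

lemma trig_polys_pointwise_L2_bound:
  fixes f :: "real ^ 'd::finite \<Rightarrow> complex"
  assumes "f \<in> trig_polys N"
  shows "(norm (f x))\<^sup>2 \<le> ((2 * real N + 1) / (2 * pi)) ^ CARD('d) * (LINT y|torus_measure. (norm (f y))\<^sup>2)"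
proof -
  let ?K = "lattice_cube N :: (int ^ 'd) set"
  obtain c where f: "f = (\<lambda>x. \<Sum>k\<in>?K. c k * character k x)"
    using assms unfolding trig_polys_def by blast
  have "norm (f x) \<le> (\<Sum>k\<in>?K. norm (c k) * 1)"
    unfolding f by (rule order_trans[OF norm_sum]) (simp add: norm_mult)
  then have "(norm (f x))\<^sup>2 \<le> (\<Sum>k\<in>?K. norm (c k) * 1)\<^sup>2"
    by (intro power_mono) auto
  also have "\<dots> \<le> (\<Sum>k\<in>?K. (norm (c k))\<^sup>2) * (\<Sum>k\<in>?K. 1\<^sup>2)"
    by (rule Cauchy_Schwarz_ineq_sum)
  also have "\<dots> = ((2 * real N + 1) / (2 * pi)) ^ CARD('d) * (LINT y|torus_measure. (norm (f y))\<^sup>2)"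
    unfolding f trig_poly_parseval[OF finite_lattice_cube]
    by (simp add: card_lattice_cube power_divide add.commute)
  finally show ?thesis .
qed

text \<open>
  The \<open>L\<^sup>2\<close> bound is applied to \<open>f ^ m\<close>, whose degree is only \<open>m\<close> times that of \<open>f\<close>.
\<close>

lemma nikolskii_bound:
  fixes f :: "real ^ 'd::finite \<Rightarrow> complex"
  assumes "f \<in> trig_polys N"
  shows "norm (f x) ^ (2 * m)
    \<le> ((2 * real (m * N) + 1) / (2 * pi)) ^ CARD('d) * (LINT y|torus_measure. norm (f y) ^ (2 * m))"
  using trig_polys_pointwise_L2_bound[OF trig_polys_power[OF assms, of m], of x]
  by (simp only: norm_power power_mult[symmetric] mult.commute[of _ 2])

section \<open>Concentration of the moments of a random trigonometric polynomial\<close>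

text \<open>
  Linearity of a distribution identifies a value of the noise with a linear combination only at the
  points of the probability space.
\<close>

lemma complex_gaussian_cong:
  assumes "\<And>\<omega>. \<omega> \<in> space M \<Longrightarrow> X \<omega> = Y \<omega>"
  shows "complex_gaussian M X \<longleftrightarrow> complex_gaussian M Y"
proof -
  have "X \<in> borel_measurable M \<longleftrightarrow> Y \<in> borel_measurable M"
    by (rule measurable_cong) (rule assms)
  moreover have "integrable M (\<lambda>\<omega>. (norm (X \<omega>))\<^sup>2) \<longleftrightarrow> integrable M (\<lambda>\<omega>. (norm (Y \<omega>))\<^sup>2)"
    by (rule Bochner_Integration.integrable_cong) (simp_all add: assms)
  moreover have "(LINT \<omega>|M. X \<omega>) = (LINT \<omega>|M. Y \<omega>)"
    by (rule Bochner_Integration.integral_cong) (simp_all add: assms)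
  moreover have "(LINT \<omega>|M. (norm (X \<omega>))\<^sup>2) = (LINT \<omega>|M. (norm (Y \<omega>))\<^sup>2)"
    by (rule Bochner_Integration.integral_cong) (simp_all add: assms)
  moreover have "(AE \<omega> in M. X \<omega> = 0) \<longleftrightarrow> (AE \<omega> in M. Y \<omega> = 0)"
    by (rule AE_cong) (simp add: assms)
  ultimately show ?thesis
    using assms unfolding complex_gaussian_def std_complex_gaussian_def by simp
qed

lemma
  assumes "white_noise M W"
  shows white_noise_prob_space: "prob_space M"
    and white_noise_distributions: "\<omega> \<in> space M \<Longrightarrow> W \<omega> \<in> distributions"
    and white_noise_measurable: "f \<in> test_functions \<Longrightarrow> (\<lambda>\<omega>. W \<omega> f) \<in> borel_measurable M"
    and white_noise_gaussian: "f \<in> test_functions \<Longrightarrow> complex_gaussian M (\<lambda>\<omega>. W \<omega> f)"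
    and white_noise_covariance: "f \<in> test_functions \<Longrightarrow> g \<in> test_functions \<Longrightarrow>
      (LINT \<omega>|M. W \<omega> f * cnj (W \<omega> g)) = torus_inner f g"
  using assms unfolding white_noise_def by blast+

lemma torus_inner_eq: "torus_inner f g = (LINT x|torus_measure. f x * cnj (g x))"
  unfolding torus_inner_def set_lebesgue_integral_def by (subst integral_restrict_space) auto

lemma white_noise_linear_combination:
  fixes W :: "'w \<Rightarrow> (real ^ 'd::finite \<Rightarrow> complex) \<Rightarrow> complex"
  assumes W: "white_noise M W" and K: "finite K"
  shows "complex_gaussian M (\<lambda>\<omega>. \<Sum>k\<in>K. c k * W \<omega> (character (- k)))"
    and "(LINT \<omega>|M. (norm (\<Sum>k\<in>K. c k * W \<omega> (character (- k))))\<^sup>2)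
           = (2 * pi) ^ CARD('d) * (\<Sum>k\<in>K. (norm (c k))\<^sup>2)"
proof -
  define f where "f x = (\<Sum>k\<in>uminus ` K. c (- k) * character k x)" for x
  have f: "f \<in> test_functions"
    unfolding f_def[abs_def] by (rule trig_poly_test_function)
  have eq: "W \<omega> f = (\<Sum>k\<in>K. c k * W \<omega> (character (- k)))" if "\<omega> \<in> space M" for \<omega>
  proof -
    have "W \<omega> \<in> distributions" using W that by (rule white_noise_distributions)
    then have "W \<omega> f = (\<Sum>k\<in>uminus ` K. c (- k) * W \<omega> (character k))"
      unfolding f_def[abs_def] using K by (intro distribution_trig_poly) auto
    then show ?thesis by (simp add: sum.reindex inj_on_def)
  qed
  have "complex_gaussian M (\<lambda>\<omega>. W \<omega> f)" using W f by (rule white_noise_gaussian)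
  then show "complex_gaussian M (\<lambda>\<omega>. \<Sum>k\<in>K. c k * W \<omega> (character (- k)))"
    by (simp only: eq cong: complex_gaussian_cong)
  have "complex_of_real (LINT \<omega>|M. (norm (W \<omega> f))\<^sup>2) = (LINT \<omega>|M. complex_of_real ((norm (W \<omega> f))\<^sup>2))"
    by (simp del: of_real_power)
  also have "\<dots> = torus_inner f f"
    unfolding complex_norm_square by (rule white_noise_covariance[OF W f f])
  also have "\<dots> = complex_of_real (LINT x|torus_measure. (norm (f x))\<^sup>2)"
    unfolding torus_inner_eq integral_complex_of_real[symmetric] complex_norm_square ..
  also have "(LINT x|torus_measure. (norm (f x))\<^sup>2) = (2 * pi) ^ CARD('d) * (\<Sum>k\<in>K. (norm (c k))\<^sup>2)"
    unfolding f_def using K by (subst trig_poly_parseval) (auto simp: sum.reindex inj_on_def)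
  finally have "(LINT \<omega>|M. (norm (W \<omega> f))\<^sup>2) = (2 * pi) ^ CARD('d) * (\<Sum>k\<in>K. (norm (c k))\<^sup>2)"
    by (simp only: of_real_eq_iff)
  moreover have "(LINT \<omega>|M. (norm (W \<omega> f))\<^sup>2)
      = (LINT \<omega>|M. (norm (\<Sum>k\<in>K. c k * W \<omega> (character (- k))))\<^sup>2)"
    by (rule Bochner_Integration.integral_cong) (simp_all add: eq)
  ultimately show "(LINT \<omega>|M. (norm (\<Sum>k\<in>K. c k * W \<omega> (character (- k))))\<^sup>2)
      = (2 * pi) ^ CARD('d) * (\<Sum>k\<in>K. (norm (c k))\<^sup>2)" by simp
qed

lemma borel_measurable_character_torus [measurable]: "character k \<in> borel_measurable torus_measure"
  by (intro measurable_restrict_space1) simp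

text \<open>
  The frequency \<open>k\<close> is paired with the character of frequency \<open>- k\<close>, as in the Fourier series of a
  distribution; \<open>b\<close> is a real Fourier multiplier.
\<close>

definition noise_series ::
    "(int ^ 'd::finite) set \<Rightarrow> (int ^ 'd \<Rightarrow> real) \<Rightarrow> ((real ^ 'd \<Rightarrow> complex) \<Rightarrow> complex) \<Rightarrow> real ^ 'd \<Rightarrow> complex" where
  "noise_series K b u x = (\<Sum>k\<in>K. complex_of_real (b k) * character k x * u (character (- k)))"

lemma continuous_on_noise_series: "continuous_on S (noise_series K b u)"
  unfolding noise_series_def[abs_def] by (intro continuous_intros)

lemma noise_series_measurable:
  fixes W :: "'w \<Rightarrow> (real ^ 'd::finite \<Rightarrow> complex) \<Rightarrow> complex"
  assumes W: "white_noise M W"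
  shows "(\<lambda>(\<omega>, x). noise_series K b (W \<omega>) x) \<in> borel_measurable (M \<Otimes>\<^sub>M torus_measure)"
proof -
  note [measurable] = white_noise_measurable[OF W character_in_test_functions]
  show ?thesis unfolding noise_series_def by measurable
qed

text \<open>
  By Tonelli, the second moment of the integral of \<open>\<bar>f\<bar> ^ (2 m)\<close> is the integral over pairs of points
  of the joint moments at these points. The constant term of the bound for the joint moments gives
  the squared mean, and the remainder is the squared correlation, whose double integral Parseval
  evaluates. The hypothesis on \<open>b\<close> normalizes the pointwise variance to \<open>1\<close>.
\<close>

lemma noise_series_variance_bound:
  fixes W :: "'w \<Rightarrow> (real ^ 'd::finite \<Rightarrow> complex) \<Rightarrow> complex"
  assumes W: "white_noise M W" and K: "finite K"
    and unit: "(2 * pi) ^ CARD('d) * (\<Sum>k\<in>K. (b k)\<^sup>2) = 1"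
  shows "(\<integral>\<^sup>+ \<omega>. ennreal (((LINT x|torus_measure. norm (noise_series K b (W \<omega>) x) ^ (2 * m))
             - (2 * pi) ^ CARD('d) * fact m)\<^sup>2) \<partial>M)
         \<le> ennreal (two_point_const m * ((2 * pi) ^ (4 * CARD('d)) * (\<Sum>k\<in>K. b k ^ 4)))"
proof -
  have M: "prob_space M" using W by (rule white_noise_prob_space)
  interpret prob_space M by fact
  interpret T: finite_measure "torus_measure :: (real ^ 'd) measure" by (rule finite_torus_measure)
  interpret P: pair_sigma_finite M "torus_measure :: (real ^ 'd) measure" ..
  note [measurable] = white_noise_measurable[OF W character_in_test_functions]
  let ?D = "(2 * pi) ^ CARD('d) :: real"
  have D: "?D > 0" by simp
  define F where "F \<omega> x = norm (noise_series K b (W \<omega>) x) ^ (2 * m)" for \<omega> x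
  define \<alpha> where "\<alpha> x y = (\<Sum>k\<in>K. complex_of_real (?D * (b k)\<^sup>2) * cnj (character k x) * character k y)"
    for x y :: "real ^ 'd"
  have F_nonneg: "0 \<le> F \<omega> x" for \<omega> x by (simp add: F_def)
  have F_cont: "continuous_on UNIV (F \<omega>)" for \<omega>
    unfolding F_def[abs_def] by (intro continuous_intros continuous_on_noise_series)
  have F_meas [measurable]: "(\<lambda>(\<omega>, x). F \<omega> x) \<in> borel_measurable (M \<Otimes>\<^sub>M torus_measure)"
    using noise_series_measurable[OF W] unfolding F_def by measurable
  have F_meas' [measurable]: "(\<lambda>\<omega>. F \<omega> x) \<in> borel_measurable M" for x
    unfolding F_def noise_series_def by measurable
  have F_meas'' [measurable]: "F \<omega> \<in> borel_measurable torus_measure" for \<omega>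
    unfolding F_def[abs_def] noise_series_def by measurable
  \<comment> \<open>The linear combinations of two values of the field are Gaussian, with correlation \<open>\<alpha>\<close>.\<close>
  have comb: "noise_series K b (W \<omega>) x + z * noise_series K b (W \<omega>) y
      = (\<Sum>k\<in>K. (b k * (character k x + z * character k y)) * W \<omega> (character (- k)))" for \<omega> x y z
    unfolding noise_series_def sum_distrib_left sum.distrib[symmetric]
    by (intro sum.cong refl) (simp add: algebra_simps)
  have gauss: "complex_gaussian M (\<lambda>\<omega>. noise_series K b (W \<omega>) x + z * noise_series K b (W \<omega>) y)" for x y z
    unfolding comb by (rule white_noise_linear_combination[OF W K])
  have cov: "(LINT \<omega>|M. (norm (noise_series K b (W \<omega>) x + z * noise_series K b (W \<omega>) y))\<^sup>2)
      = 1 + (norm z)\<^sup>2 + 2 * Re (z * \<alpha> x y)" for x y z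
  proof -
    have sq: "(norm (character k x + z * character k y))\<^sup>2
        = 1 + (norm z)\<^sup>2 + 2 * Re (z * (cnj (character k x) * character k y))" for k
    proof -
      have "(norm (a + c))\<^sup>2 = (norm a)\<^sup>2 + (norm c)\<^sup>2 + 2 * Re (cnj a * c)" for a c :: complex
        by (simp add: cmod_power2) (simp add: power2_eq_square algebra_simps)
      from this[of "character k x" "z * character k y"] show ?thesis
        by (simp add: norm_mult mult_ac)
    qed
    have "(LINT \<omega>|M. (norm (noise_series K b (W \<omega>) x + z * noise_series K b (W \<omega>) y))\<^sup>2)
        = ?D * (\<Sum>k\<in>K. (b k)\<^sup>2 * (1 + (norm z)\<^sup>2 + 2 * Re (z * (cnj (character k x) * character k y))))"
      unfolding comb white_noise_linear_combination(2)[OF W K] by (simp add: norm_mult power_mult_distrib sq)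
    also have "\<dots> = (1 + (norm z)\<^sup>2) * (?D * (\<Sum>k\<in>K. (b k)\<^sup>2)) + 2 * Re (z * \<alpha> x y)"
    proof -
      have "z * \<alpha> x y = (\<Sum>k\<in>K. (?D * (b k)\<^sup>2) *\<^sub>R (z * (cnj (character k x) * character k y)))"
        unfolding \<alpha>_def sum_distrib_left scaleR_conv_of_real by (simp only: mult_ac)
      then have "Re (z * \<alpha> x y) = (\<Sum>k\<in>K. (?D * (b k)\<^sup>2) * Re (z * (cnj (character k x) * character k y)))"
        by (simp only: Re_sum scaleR_complex.sel)
      then show ?thesis
        by (simp only: sum_distrib_left sum.distrib distrib_left distrib_right mult_ac)
    qed
    finally show ?thesis using unit by simp
  qed
  note two_point = two_point_moment_bound[where m = m, OF M _ gauss cov, folded F_def]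
  have gauss1: "complex_gaussian M (\<lambda>\<omega>. noise_series K b (W \<omega>) x)" for x
    using gauss[of x 0] by simp
  have cov1: "(LINT \<omega>|M. (norm (noise_series K b (W \<omega>) x))\<^sup>2) = 1" for x
    using cov[of x 0] by simp
  have first: "(\<integral>\<^sup>+\<omega>. ennreal (F \<omega> x) \<partial>M) = ennreal (fact m)" for x
    using complex_gaussian_moment[OF M gauss1, of x m]
    by (subst nn_integral_eq_integral) (auto simp: has_bochner_integral_iff F_def cov1)
  have second: "(\<integral>\<^sup>+\<omega>. ennreal (F \<omega> x) * ennreal (F \<omega> y) \<partial>M)
      \<le> ennreal ((fact m)\<^sup>2 + two_point_const m * (norm (\<alpha> x y))\<^sup>2)" for x y
  proof -
    have "(\<integral>\<^sup>+\<omega>. ennreal (F \<omega> x) * ennreal (F \<omega> y) \<partial>M) = (\<integral>\<^sup>+\<omega>. ennreal (F \<omega> x * F \<omega> y) \<partial>M)"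
      by (simp add: ennreal_mult F_nonneg)
    also have "\<dots> = ennreal (LINT \<omega>|M. F \<omega> x * F \<omega> y)"
      using two_point(1)[OF gauss1] by (intro nn_integral_eq_integral) (auto simp: F_nonneg)
    also have "\<dots> \<le> ennreal ((fact m)\<^sup>2 + two_point_const m * (norm (\<alpha> x y))\<^sup>2)"
      by (intro ennreal_leI two_point(2) gauss1)
    finally show ?thesis .
  qed
  have alpha_int: "(LINT y|torus_measure. (norm (\<alpha> x y))\<^sup>2) = ?D ^ 3 * (\<Sum>k\<in>K. b k ^ 4)" for x
  proof -
    have "(LINT y|torus_measure. (norm (\<alpha> x y))\<^sup>2)
        = ?D * (\<Sum>k\<in>K. (norm (complex_of_real (?D * (b k)\<^sup>2) * cnj (character k x)))\<^sup>2)"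
      unfolding \<alpha>_def by (rule trig_poly_parseval[OF K])
    also have "\<dots> = ?D ^ 3 * (\<Sum>k\<in>K. b k ^ 4)"
    proof -
      have "norm (complex_of_real (?D * (b k)\<^sup>2) * cnj (character k x)) = ?D * (b k)\<^sup>2" for k
        unfolding norm_mult complex_mod_cnj norm_character norm_of_real by simp
      then have "(norm (complex_of_real (?D * (b k)\<^sup>2) * cnj (character k x)))\<^sup>2 = ?D\<^sup>2 * b k ^ 4" for k
        by (simp only: power_mult_distrib flip: power_mult) simp
      then show ?thesis by (simp only: sum_distrib_left power3_eq_cube power2_eq_square mult.assoc)
    qed
    finally show ?thesis .
  qed
  have alpha_cont: "continuous_on UNIV (\<lambda>y. (fact m)\<^sup>2 + two_point_const m * (norm (\<alpha> x y))\<^sup>2)" for x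
    unfolding \<alpha>_def by (intro continuous_intros)
  define Z where "Z \<omega> = (LINT x|torus_measure. F \<omega> x)" for \<omega>
  have Z_nn: "ennreal (Z \<omega>) = (\<integral>\<^sup>+x. ennreal (F \<omega> x) \<partial>torus_measure)" for \<omega>
    unfolding Z_def
    by (intro nn_integral_eq_integral[symmetric] integrable_torus_continuous F_cont) (simp add: F_nonneg)
  have Z_nonneg: "0 \<le> Z \<omega>" for \<omega> unfolding Z_def by (intro integral_nonneg_AE) (simp add: F_nonneg)
  have [measurable]: "Z \<in> borel_measurable M" unfolding Z_def[abs_def] by measurable
  let ?\<mu> = "?D * fact m"
  let ?V = "?D ^ 4 * (\<Sum>k\<in>K. b k ^ 4)"
  have EZ: "(\<integral>\<^sup>+\<omega>. ennreal (Z \<omega>) \<partial>M) = ennreal ?\<mu>"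
  proof -
    have "(\<integral>\<^sup>+\<omega>. ennreal (Z \<omega>) \<partial>M) = (\<integral>\<^sup>+x. \<integral>\<^sup>+\<omega>. ennreal (F \<omega> x) \<partial>M \<partial>torus_measure)"
      unfolding Z_nn by (rule P.Fubini'[symmetric]) measurable
    also have "\<dots> = ennreal ?\<mu>"
      unfolding first by (simp add: emeasure_torus ennreal_mult mult.commute)
    finally show ?thesis .
  qed
  have EZ2: "(\<integral>\<^sup>+\<omega>. ennreal ((Z \<omega>)\<^sup>2) \<partial>M) \<le> ennreal (?\<mu>\<^sup>2 + two_point_const m * ?V)"
  proof -
    have "(\<integral>\<^sup>+\<omega>. ennreal ((Z \<omega>)\<^sup>2) \<partial>M)
        = (\<integral>\<^sup>+\<omega>. (\<integral>\<^sup>+x. (\<integral>\<^sup>+y. ennreal (F \<omega> x) * ennreal (F \<omega> y) \<partial>torus_measure) \<partial>torus_measure) \<partial>M)"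
      by (simp add: power2_eq_square ennreal_mult Z_nonneg Z_nn nn_integral_cmult nn_integral_multc)
    also have "\<dots> = (\<integral>\<^sup>+x. (\<integral>\<^sup>+\<omega>. (\<integral>\<^sup>+y. ennreal (F \<omega> x) * ennreal (F \<omega> y) \<partial>torus_measure) \<partial>M) \<partial>torus_measure)"
      by (rule P.Fubini'[symmetric]) measurable
    also have "\<dots> = (\<integral>\<^sup>+x. (\<integral>\<^sup>+y. (\<integral>\<^sup>+\<omega>. ennreal (F \<omega> x) * ennreal (F \<omega> y) \<partial>M) \<partial>torus_measure) \<partial>torus_measure)"
      by (intro nn_integral_cong P.Fubini'[symmetric]) measurable
    also have "\<dots> \<le> (\<integral>\<^sup>+(x::real^'d). (\<integral>\<^sup>+y. ennreal ((fact m)\<^sup>2 + two_point_const m * (norm (\<alpha> x y))\<^sup>2) \<partial>torus_measure) \<partial>torus_measure)"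
      by (intro nn_integral_mono second)
    also have "\<dots> = (\<integral>\<^sup>+(x::real^'d). ennreal (?D * (fact m)\<^sup>2 + two_point_const m * (?D ^ 3 * (\<Sum>k\<in>K. b k ^ 4))) \<partial>torus_measure)"
    proof (rule nn_integral_cong)
      fix x :: "real ^ 'd"
      have i: "integrable torus_measure (\<lambda>y. (norm (\<alpha> x y))\<^sup>2)"
        unfolding \<alpha>_def by (intro integrable_torus_continuous continuous_intros)
      have "(\<integral>\<^sup>+y. ennreal ((fact m)\<^sup>2 + two_point_const m * (norm (\<alpha> x y))\<^sup>2) \<partial>torus_measure)
          = ennreal (LINT y|torus_measure. (fact m)\<^sup>2 + two_point_const m * (norm (\<alpha> x y))\<^sup>2)"
        by (intro nn_integral_eq_integral integrable_torus_continuous alpha_cont)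
          (simp add: two_point_const_nonneg)
      also have "(LINT y|torus_measure. (fact m)\<^sup>2 + two_point_const m * (norm (\<alpha> x y))\<^sup>2)
          = ?D * (fact m)\<^sup>2 + two_point_const m * (?D ^ 3 * (\<Sum>k\<in>K. b k ^ 4))"
        using i by (subst Bochner_Integration.integral_add) (auto simp: measure_torus alpha_int)
      finally show "(\<integral>\<^sup>+y. ennreal ((fact m)\<^sup>2 + two_point_const m * (norm (\<alpha> x y))\<^sup>2) \<partial>torus_measure)
          = ennreal (?D * (fact m)\<^sup>2 + two_point_const m * (?D ^ 3 * (\<Sum>k\<in>K. b k ^ 4)))" .
    qed
    also have "\<dots> = ennreal ((?D * (fact m)\<^sup>2 + two_point_const m * (?D ^ 3 * (\<Sum>k\<in>K. b k ^ 4))) * ?D)"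
      by (subst ennreal_mult) (auto simp: emeasure_torus two_point_const_nonneg sum_nonneg)
    also have "(?D * (fact m)\<^sup>2 + two_point_const m * (?D ^ 3 * (\<Sum>k\<in>K. b k ^ 4))) * ?D
        = ?\<mu>\<^sup>2 + two_point_const m * ?V"
      by (simp add: algebra_simps power2_eq_square power3_eq_cube power4_eq_xxxx)
    finally show ?thesis .
  qed
  have Z_int: "integrable M Z"
    by (rule integrableI_nonneg) (auto simp: Z_nonneg EZ)
  have Z2_int: "integrable M (\<lambda>\<omega>. (Z \<omega>)\<^sup>2)"
    using EZ2 by (intro integrableI_nonneg) (auto intro: le_less_trans)
  have lint_Z: "(LINT \<omega>|M. Z \<omega>) = ?\<mu>"
    using EZ by (intro integral_eq_nn_integral[THEN trans]) (auto simp: Z_nonneg)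
  have lint_Z2: "(LINT \<omega>|M. (Z \<omega>)\<^sup>2) \<le> ?\<mu>\<^sup>2 + two_point_const m * ?V"
  proof (rule ennreal_le_iff[THEN iffD1])
    show "0 \<le> ?\<mu>\<^sup>2 + two_point_const m * ?V"
      by (intro add_nonneg_nonneg mult_nonneg_nonneg two_point_const_nonneg sum_nonneg) auto
    have "(\<integral>\<^sup>+\<omega>. ennreal ((Z \<omega>)\<^sup>2) \<partial>M) = ennreal (LINT \<omega>|M. (Z \<omega>)\<^sup>2)"
      by (intro nn_integral_eq_integral Z2_int) simp
    with EZ2 show "ennreal (LINT \<omega>|M. (Z \<omega>)\<^sup>2) \<le> ennreal (?\<mu>\<^sup>2 + two_point_const m * ?V)"
      by (simp only:)
  qed
  have exp_sq: "(Z \<omega> - ?\<mu>)\<^sup>2 = (Z \<omega>)\<^sup>2 - 2 * ?\<mu> * Z \<omega> + ?\<mu>\<^sup>2" for \<omega>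
    by (simp add: power2_diff)
  have sq_int: "integrable M (\<lambda>\<omega>. (Z \<omega> - ?\<mu>)\<^sup>2)"
    unfolding exp_sq using Z_int Z2_int by auto
  have "(\<integral>\<^sup>+\<omega>. ennreal ((Z \<omega> - ?\<mu>)\<^sup>2) \<partial>M) = ennreal (LINT \<omega>|M. (Z \<omega> - ?\<mu>)\<^sup>2)"
    by (intro nn_integral_eq_integral sq_int) simp
  also have "(LINT \<omega>|M. (Z \<omega> - ?\<mu>)\<^sup>2) = (LINT \<omega>|M. (Z \<omega>)\<^sup>2) - 2 * ?\<mu> * ?\<mu> + ?\<mu>\<^sup>2"
    unfolding exp_sq using Z_int Z2_int by (simp add: lint_Z prob_space)
  also have "ennreal \<dots> \<le> ennreal (two_point_const m * ?V)"
  proof (rule ennreal_leI)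
    have "2 * ?\<mu> * ?\<mu> = 2 * ?\<mu>\<^sup>2" by (simp only: power2_eq_square mult.assoc)
    with lint_Z2 show "(LINT \<omega>|M. (Z \<omega>)\<^sup>2) - 2 * ?\<mu> * ?\<mu> + ?\<mu>\<^sup>2 \<le> two_point_const m * ?V"
      by linarith
  qed
  finally show ?thesis
    by (simp add: Z_def F_def power_mult mult.commute[of 4])
qed

section \<open>Littlewood-Paley blocks of white noise\<close>

lemma
  assumes "dyadic_partition \<phi>"
  shows dyadic_partition_nonneg: "0 \<le> \<phi> t"
    and dyadic_partition_support: "\<phi> t \<noteq> 0 \<Longrightarrow> 1 / 2 \<le> norm t \<and> norm t \<le> 2"
    and dyadic_partition_sum: "t \<noteq> 0 \<Longrightarrow> ((\<lambda>j::int. \<phi> ((2 powi (- j)) *\<^sub>R t)) has_sum 1) UNIV"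
    and dyadic_partition_isCont: "isCont \<phi> t"
proof -
  show "0 \<le> \<phi> t" "t \<noteq> 0 \<Longrightarrow> ((\<lambda>j::int. \<phi> ((2 powi (- j)) *\<^sub>R t)) has_sum 1) UNIV"
    using assms unfolding dyadic_partition_def by blast+
  show "\<phi> t \<noteq> 0 \<Longrightarrow> 1 / 2 \<le> norm t \<and> norm t \<le> 2"
    using assms closure_subset[of "{t. \<phi> t \<noteq> 0}"] unfolding dyadic_partition_def by blast
  have "multi_deriv [] \<phi> differentiable (at t)"
    using assms unfolding dyadic_partition_def smooth_def by blast
  then show "isCont \<phi> t"
    using differentiable_imp_continuous_within by auto
qed

text \<open>
  At \<open>t \<noteq> 0\<close> the value is the term of index \<open>0\<close> of a series of nonnegative terms with sum \<open>1\<close>.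
\<close>

lemma dyadic_partition_le_1:
  assumes "dyadic_partition \<phi>"
  shows "\<phi> t \<le> 1"
proof (cases "t = 0")
  case True
  then show ?thesis using dyadic_partition_support[OF assms, of t] by fastforce
next
  case False
  have "(\<Sum>j\<in>{0::int}. \<phi> ((2 powi (- j)) *\<^sub>R t)) \<le> 1"
    by (rule finite_sum_le_has_sum[OF dyadic_partition_sum[OF assms False]])
      (auto simp: dyadic_partition_nonneg[OF assms])
  then show ?thesis by simp
qed

lemma dyadic_partition_pos: "dyadic_partition \<phi> \<Longrightarrow> \<exists>t. 0 < \<phi> (t :: real ^ 'd::finite)"
proof (rule ccontr)
  assume \<phi>: "dyadic_partition \<phi>" and "\<not> (\<exists>t. 0 < \<phi> t)"
  then have "\<phi> t = 0" for t
    using dyadic_partition_nonneg[OF \<phi>, of t] by (metis less_eq_real_def)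
  then have "((\<lambda>_::int. 0::real) has_sum 1) UNIV"
    using dyadic_partition_sum[OF \<phi>, of "axis undefined 1"] by (simp add: axis_eq_0_iff)
  then show False
    using has_sum_unique[OF has_sum_0] by fastforce
qed

definition block_freqs :: "(real ^ 'd::finite \<Rightarrow> real) \<Rightarrow> nat \<Rightarrow> (int ^ 'd) set" where
  "block_freqs \<phi> j = {k. lp_cutoff \<phi> j (freq k) \<noteq> 0}"

text \<open>
  Up to a power of \<open>2 \<pi>\<close> this is the pointwise variance of the block of white noise.
\<close>

definition block_energy :: "(real ^ 'd::finite \<Rightarrow> real) \<Rightarrow> nat \<Rightarrow> real" where
  "block_energy \<phi> j = (\<Sum>k\<in>block_freqs \<phi> j. (lp_cutoff \<phi> j (freq k))\<^sup>2)"

lemma lp_cutoff_pos: "0 < j \<Longrightarrow> lp_cutoff \<phi> j t = \<phi> ((1 / 2) ^ j *\<^sub>R t)"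
  by (simp add: lp_cutoff_def)

lemma block_freqs_subset_cube:
  fixes \<phi> :: "real ^ 'd::finite \<Rightarrow> real"
  assumes \<phi>: "dyadic_partition \<phi>" and j: "0 < j"
  shows "block_freqs \<phi> j \<subseteq> lattice_cube (2 * 2 ^ j)"
proof
  fix k assume "k \<in> block_freqs \<phi> j"
  then have "\<phi> ((1 / 2) ^ j *\<^sub>R freq k) \<noteq> 0"
    using j by (simp add: block_freqs_def lp_cutoff_pos)
  then have "norm ((1 / 2) ^ j *\<^sub>R freq k) \<le> 2"
    using dyadic_partition_support[OF \<phi>] by blast
  then have n: "norm (freq k) \<le> 2 * 2 ^ j"
    by (simp add: power_divide field_simps)
  show "k \<in> lattice_cube (2 * 2 ^ j)"
    unfolding lattice_cube_def
  proof (intro CollectI allI)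
    fix i
    have "real_of_int \<bar>k $ i\<bar> \<le> norm (freq k)"
      using component_le_norm_cart[of "freq k" i] by (simp add: freq_def)
    also have "\<dots> \<le> real_of_int (int (2 * 2 ^ j))" using n by simp
    finally show "\<bar>k $ i\<bar> \<le> int (2 * 2 ^ j)" by linarith
  qed
qed

lemma finite_block_freqs: "dyadic_partition \<phi> \<Longrightarrow> 0 < j \<Longrightarrow> finite (block_freqs \<phi> j)"
  using block_freqs_subset_cube finite_lattice_cube by (rule finite_subset)

lemma block_energy_upper:
  fixes \<phi> :: "real ^ 'd::finite \<Rightarrow> real"
  assumes \<phi>: "dyadic_partition \<phi>" and j: "0 < j"
  shows "block_energy \<phi> j \<le> 5 ^ CARD('d) * 2 ^ (j * CARD('d))"
proof -
  have "block_energy \<phi> j \<le> (\<Sum>k\<in>block_freqs \<phi> j. 1)"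
    unfolding block_energy_def lp_cutoff_pos[OF j]
    by (intro sum_mono power_le_one dyadic_partition_nonneg[OF \<phi>] dyadic_partition_le_1[OF \<phi>])
  also have "\<dots> = real (card (block_freqs \<phi> j))" by simp
  also have "card (block_freqs \<phi> j) \<le> card (lattice_cube (2 * 2 ^ j) :: (int ^ 'd) set)"
    by (intro card_mono finite_lattice_cube block_freqs_subset_cube \<phi> j)
  also have "\<dots> = (2 * (2 * 2 ^ j) + 1) ^ CARD('d)"
    by (rule card_lattice_cube)
  also have "\<dots> \<le> (5 * 2 ^ j) ^ CARD('d)"
    by (intro power_mono) auto
  also have "real ((5 * 2 ^ j) ^ CARD('d)) = 5 ^ CARD('d) * 2 ^ (j * CARD('d))"
    by (simp add: power_mult_distrib power_mult)
  finally show ?thesis by simp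
qed

lemma card_int_interval_lower:
  assumes "1 \<le> l"
  shows "l \<le> real (card {\<lceil>a - l\<rceil>..\<lfloor>a + l\<rfloor>})"
proof -
  have "l \<le> real_of_int (\<lfloor>a + l\<rfloor> - \<lceil>a - l\<rceil> + 1)"
    using assms by linarith
  then show ?thesis using assms by simp
qed

text \<open>
  The cutoff is bounded below by a positive constant on a small cube around some point. Dilated by
  \<open>2 ^ j\<close>, this cube contains a number of lattice points of the order of its volume, once its side
  is long enough.
\<close>

lemma block_energy_lower:
  fixes \<phi> :: "real ^ 'd::finite \<Rightarrow> real"
  assumes \<phi>: "dyadic_partition \<phi>"
  shows "\<exists>c>0. eventually (\<lambda>j. c * 2 ^ (j * CARD('d)) \<le> block_energy \<phi> j) sequentially"
proof -
  obtain t0 where t0: "0 < \<phi> t0" using dyadic_partition_pos[OF \<phi>] by blast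
  define \<delta> where "\<delta> = \<phi> t0 / 2"
  have \<delta>: "\<delta> > 0" using t0 by (simp add: \<delta>_def)
  obtain \<epsilon> where \<epsilon>: "\<epsilon> > 0" and near: "\<And>t. dist t t0 < \<epsilon> \<Longrightarrow> dist (\<phi> t) (\<phi> t0) < \<delta>"
    using dyadic_partition_isCont[OF \<phi>, of t0] \<delta> unfolding continuous_at_eps_delta
    by (metis dist_commute)
  have big: "\<delta> \<le> \<phi> t" if "dist t t0 < \<epsilon>" for t
    using near[OF that] unfolding dist_real_def \<delta>_def abs_less_iff by linarith
  \<comment> \<open>The cube of half side \<open>r\<close> fits into the ball of radius \<open>\<epsilon>\<close>, since the Euclidean norm is at
    most the sum of the moduli of the coordinates.\<close>
  define r where "r = \<epsilon> / (2 * CARD('d))"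
  have r: "r > 0" using \<epsilon> by (simp add: r_def)
  have "filterlim (\<lambda>j. (2::real) ^ j * r) at_top sequentially"
    using r by real_asymp
  then have "eventually (\<lambda>j. 1 \<le> 2 ^ j * r) sequentially"
    by (simp add: filterlim_at_top)
  then have "eventually (\<lambda>j. \<delta>\<^sup>2 * r ^ CARD('d) * 2 ^ (j * CARD('d)) \<le> block_energy \<phi> j) sequentially"
    using eventually_gt_at_top[of 0]
  proof eventually_elim
    case (elim j)
    define A where "A i = {\<lceil>2 ^ j * t0 $ i - 2 ^ j * r\<rceil>..\<lfloor>2 ^ j * t0 $ i + 2 ^ j * r\<rfloor>}" for i
    define B where "B = {k :: int ^ 'd. \<forall>i. k $ i \<in> A i}"
    have cutoff: "\<delta> \<le> lp_cutoff \<phi> j (freq k)" if "k \<in> B" for k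
    proof -
      have "\<bar>((1 / 2) ^ j *\<^sub>R freq k - t0) $ i\<bar> \<le> r" for i
      proof -
        have "k $ i \<in> A i" using that by (simp add: B_def)
        then have "\<bar>real_of_int (k $ i) - 2 ^ j * t0 $ i\<bar> \<le> 2 ^ j * r"
          unfolding A_def atLeastAtMost_iff ceiling_le_iff le_floor_iff by (simp add: abs_le_iff)
        then have "2 ^ j * \<bar>(1 / 2) ^ j * real_of_int (k $ i) - t0 $ i\<bar> \<le> 2 ^ j * r"
          by (subst abs_of_pos[of "2 ^ j", symmetric], simp, subst abs_mult[symmetric])
            (simp add: right_diff_distrib flip: mult.assoc power_mult_distrib)
        then show ?thesis by (simp add: freq_def)
      qed
      then have "norm ((1 / 2) ^ j *\<^sub>R freq k - t0) \<le> (\<Sum>i\<in>(UNIV :: 'd set). r)"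
        by (intro order_trans[OF norm_le_l1_cart] sum_mono)
      also have "\<dots> < \<epsilon>" using \<epsilon> by (simp add: r_def)
      finally show ?thesis
        using big elim(2) by (simp add: lp_cutoff_pos dist_norm)
    qed
    have "\<delta>\<^sup>2 * r ^ CARD('d) * 2 ^ (j * CARD('d)) = (\<Prod>i\<in>(UNIV :: 'd set). 2 ^ j * r) * \<delta>\<^sup>2"
      by (simp add: power_mult_distrib power_mult mult_ac)
    also have "\<dots> \<le> (\<Prod>i\<in>UNIV. real (card (A i))) * \<delta>\<^sup>2"
      using r unfolding A_def by (intro mult_right_mono prod_mono conjI card_int_interval_lower elim(1)) auto
    also have "\<dots> = real (card B) * \<delta>\<^sup>2"
      unfolding B_def by (subst card_lattice_box) (auto simp: A_def)
    also have "\<dots> = (\<Sum>k\<in>B. \<delta>\<^sup>2)" by simp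
    also have "\<dots> \<le> (\<Sum>k\<in>B. (lp_cutoff \<phi> j (freq k))\<^sup>2)"
      using \<delta> cutoff by (intro sum_mono power_mono) auto
    also have "\<dots> \<le> block_energy \<phi> j"
      unfolding block_energy_def using elim(2) finite_block_freqs[OF \<phi>] cutoff \<delta>
      by (intro sum_mono2) (auto simp: block_freqs_def B_def[symmetric] dest!: cutoff)
    finally show ?case .
  qed
  moreover have "0 < \<delta>\<^sup>2 * r ^ CARD('d)" using \<delta> r by simp
  ultimately show ?thesis by blast
qed

text \<open>
  The pointwise standard deviation of the block of white noise.
\<close>

definition block_sd :: "(real ^ 'd::finite \<Rightarrow> real) \<Rightarrow> nat \<Rightarrow> real" where
  "block_sd \<phi> j = sqrt (block_energy \<phi> j / (2 * pi) ^ CARD('d))"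

lemma lp_block_eq_noise_series:
  "lp_block \<phi> j u = noise_series (block_freqs \<phi> j) (\<lambda>k. lp_cutoff \<phi> j (freq k) / (2 * pi) ^ CARD('d)) u"
  for \<phi> :: "real ^ 'd::finite \<Rightarrow> real"
proof
  fix x
  have e: "(\<lambda>x. exp (- \<i> * complex_of_real (freq k \<bullet> x))) = character (- k)" for k :: "int ^ 'd"
    by (simp add: character_def freq_uminus fun_eq_iff)
  show "lp_block \<phi> j u x
      = noise_series (block_freqs \<phi> j) (\<lambda>k. lp_cutoff \<phi> j (freq k) / (2 * pi) ^ CARD('d)) u x"
    unfolding lp_block_def noise_series_def fourier_coeff_def e block_freqs_def
    by (simp add: character_def mult_ac)
qed

lemma noise_series_scale:
  "noise_series K (\<lambda>k. r * b k) u x = complex_of_real r * noise_series K b u x"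
  unfolding noise_series_def by (simp add: sum_distrib_left mult_ac)

text \<open>
  The variance of the normalized moment is at most of the order of \<open>2 ^ (- j)\<close>, since the energy of
  the block grows at least like \<open>2 ^ j\<close>. Hence the sum over \<open>j\<close> of the squared deviations has
  finite expectation and is almost surely finite.
\<close>

lemma lp_block_moment_tendsto:
  fixes W :: "'w \<Rightarrow> (real ^ 'd::finite \<Rightarrow> complex) \<Rightarrow> complex"
  assumes W: "white_noise M W" and \<phi>: "dyadic_partition \<phi>"
  shows "AE \<omega> in M. (\<lambda>j. (LINT x|torus_measure. (norm (lp_block \<phi> j (W \<omega>) x) / block_sd \<phi> j) ^ (2 * m)))
           \<longlonglongrightarrow> (2 * pi) ^ CARD('d) * fact m"
proof -
  let ?D = "(2 * pi) ^ CARD('d) :: real"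
  let ?\<mu> = "?D * fact m"
  interpret prob_space M using W by (rule white_noise_prob_space)
  interpret T: finite_measure "torus_measure :: (real ^ 'd) measure" by (rule finite_torus_measure)
  obtain c where c: "c > 0" and ev: "eventually (\<lambda>j. c * 2 ^ (j * CARD('d)) \<le> block_energy \<phi> j) sequentially"
    using block_energy_lower[OF \<phi>] by blast
  have "eventually (\<lambda>j. c * 2 ^ (j * CARD('d)) \<le> block_energy \<phi> j \<and> 0 < j) sequentially"
    using ev eventually_gt_at_top[of 0] by eventually_elim auto
  then obtain J where J: "\<And>j. J \<le> j \<Longrightarrow> c * 2 ^ (j * CARD('d)) \<le> block_energy \<phi> j \<and> 0 < j"
    unfolding eventually_sequentially by blast
  define Z where "Z j \<omega> = (LINT x|torus_measure. (norm (lp_block \<phi> j (W \<omega>) x) / block_sd \<phi> j) ^ (2 * m))" for j \<omega>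
  have Z_meas [measurable]: "Z j \<in> borel_measurable M" for j
  proof -
    have [measurable]: "(\<lambda>(\<omega>, x). lp_block \<phi> j (W \<omega>) x) \<in> borel_measurable (M \<Otimes>\<^sub>M torus_measure)"
      unfolding lp_block_eq_noise_series by (rule noise_series_measurable[OF W])
    show ?thesis unfolding Z_def[abs_def] by measurable
  qed
  define C where "C = two_point_const m * ?D\<^sup>2 / c"
  have C: "C \<ge> 0" using c by (simp add: C_def two_point_const_nonneg)
  have var: "(\<integral>\<^sup>+\<omega>. ennreal ((Z j \<omega> - ?\<mu>)\<^sup>2) \<partial>M) \<le> ennreal (C * (1 / 2) ^ j)" if "J \<le> j" for j
  proof -
    have j: "0 < j" and low: "c * 2 ^ (j * CARD('d)) \<le> block_energy \<phi> j" using J[OF that] by auto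
    have E: "0 < block_energy \<phi> j" using low c by (smt (verit) mult_pos_pos zero_less_power)
    \<comment> \<open>Division of the cutoff by \<open>s\<close> makes the pointwise variance equal to \<open>1\<close>.\<close>
    define s where "s = sqrt (?D * block_energy \<phi> j)"
    have s: "s > 0" "s\<^sup>2 = ?D * block_energy \<phi> j" using E by (auto simp: s_def)
    define b where "b k = lp_cutoff \<phi> j (freq k) / s" for k :: "int ^ 'd"
    let ?K = "block_freqs \<phi> j"
    have unit: "?D * (\<Sum>k\<in>?K. (b k)\<^sup>2) = 1"
      unfolding b_def power_divide s(2) sum_divide_distrib[symmetric] block_energy_def[symmetric]
      using E by simp
    have sd: "block_sd \<phi> j > 0" "block_sd \<phi> j = s / ?D"
      using E unfolding block_sd_def s_def by (auto simp: real_sqrt_divide real_sqrt_mult real_div_sqrt field_simps)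
    have block: "norm (lp_block \<phi> j u x) / block_sd \<phi> j = norm (noise_series ?K b u x)" for u x
    proof -
      have "(\<lambda>k. lp_cutoff \<phi> j (freq k) / ?D) = (\<lambda>k. block_sd \<phi> j * b k)"
        using s(1) by (simp add: b_def sd(2) fun_eq_iff)
      then show ?thesis
        unfolding lp_block_eq_noise_series using sd(1) by (simp add: noise_series_scale norm_mult)
    qed
    have b2: "(b k)\<^sup>2 \<le> 1 / s\<^sup>2" for k
      unfolding b_def power_divide lp_cutoff_pos[OF j]
      by (intro divide_right_mono power_le_one dyadic_partition_nonneg[OF \<phi>] dyadic_partition_le_1[OF \<phi>]) auto
    have "(\<Sum>k\<in>?K. b k ^ 4) \<le> (\<Sum>k\<in>?K. (1 / s\<^sup>2) * (b k)\<^sup>2)"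
    proof (rule sum_mono)
      fix k
      have "b k ^ 4 = (b k)\<^sup>2 * (b k)\<^sup>2" by (simp flip: power_add)
      also have "\<dots> \<le> (1 / s\<^sup>2) * (b k)\<^sup>2" by (intro mult_right_mono b2) simp
      finally show "b k ^ 4 \<le> (1 / s\<^sup>2) * (b k)\<^sup>2" .
    qed
    also have "\<dots> = 1 / (?D\<^sup>2 * block_energy \<phi> j)"
      unfolding sum_distrib_left[symmetric] s(2) using unit E
      by (simp add: field_simps power2_eq_square)
    finally have "?D ^ 4 * (\<Sum>k\<in>?K. b k ^ 4) \<le> ?D ^ 4 * (1 / (?D\<^sup>2 * block_energy \<phi> j))"
      by (intro mult_left_mono) auto
    also have "\<dots> = ?D\<^sup>2 / block_energy \<phi> j"
      by (simp add: power2_eq_square power4_eq_xxxx)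
    also have "\<dots> \<le> ?D\<^sup>2 / (c * 2 ^ (j * CARD('d)))"
      using low c E by (intro divide_left_mono) auto
    also have "\<dots> \<le> ?D\<^sup>2 / (c * 2 ^ j)"
      using c by (intro divide_left_mono mult_left_mono power_increasing) auto
    finally have "two_point_const m * (?D ^ 4 * (\<Sum>k\<in>?K. b k ^ 4)) \<le> two_point_const m * (?D\<^sup>2 / (c * 2 ^ j))"
      by (intro mult_left_mono two_point_const_nonneg)
    also have "\<dots> = C * (1 / 2) ^ j" by (simp add: C_def power_divide)
    finally have le: "two_point_const m * ((2 * pi) ^ (4 * CARD('d)) * (\<Sum>k\<in>?K. b k ^ 4)) \<le> C * (1 / 2) ^ j"
      by (simp add: power_mult mult.commute[of 4])
    show ?thesis
      unfolding Z_def block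
      by (rule order_trans[OF noise_series_variance_bound[OF W finite_block_freqs[OF \<phi> j] unit] ennreal_leI[OF le]])
  qed
  have "(\<integral>\<^sup>+\<omega>. (\<Sum>j. ennreal ((Z (j + J) \<omega> - ?\<mu>)\<^sup>2)) \<partial>M)
      = (\<Sum>j. \<integral>\<^sup>+\<omega>. ennreal ((Z (j + J) \<omega> - ?\<mu>)\<^sup>2) \<partial>M)"
    by (rule nn_integral_suminf) measurable
  also have "\<dots> \<le> (\<Sum>j. ennreal (C * (1 / 2) ^ (j + J)))"
    by (intro suminf_le var) auto
  also have "\<dots> < \<infinity>"
  proof -
    have "summable (\<lambda>j. C * (1 / 2) ^ (j + J))"
      unfolding power_add mult.assoc[symmetric]
      by (intro summable_mult2 summable_mult summable_geometric) simp
    then show ?thesis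
      using C by (subst suminf_ennreal2) auto
  qed
  finally have "AE \<omega> in M. (\<Sum>j. ennreal ((Z (j + J) \<omega> - ?\<mu>)\<^sup>2)) \<noteq> \<infinity>"
    by (intro nn_integral_PInf_AE) auto
  then show ?thesis
  proof eventually_elim
    case (elim \<omega>)
    then have "summable (\<lambda>j. (Z (j + J) \<omega> - ?\<mu>)\<^sup>2)"
      by (intro summable_suminf_not_top) (auto simp: infinity_ennreal_def)
    then have "(\<lambda>j. sqrt ((Z (j + J) \<omega> - ?\<mu>)\<^sup>2)) \<longlonglongrightarrow> sqrt 0"
      by (intro tendsto_real_sqrt summable_LIMSEQ_zero)
    then have "(\<lambda>j. Z (j + J) \<omega> - ?\<mu>) \<longlonglongrightarrow> 0"
      by (simp add: tendsto_rabs_zero_iff)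
    then have "(\<lambda>j. Z (j + J) \<omega>) \<longlonglongrightarrow> ?\<mu>" by (simp add: LIM_zero_iff)
    then show ?case unfolding Z_def[symmetric] by (rule LIMSEQ_offset)
  qed
qed

section \<open>Lebesgue norms of a function from its moments\<close>

lemma one_le_enn2real: "1 \<le> p \<Longrightarrow> p < \<infinity> \<Longrightarrow> 1 \<le> enn2real p"
  by (cases p) (auto simp flip: ennreal_1)

lemma ennpowr_ennreal: "0 \<le> r \<Longrightarrow> ennpowr (ennreal r) a = ennreal (r powr a)"
  by (simp add: ennpowr_def)

lemma ennpowr_eq_top_iff: "ennpowr x a = \<top> \<longleftrightarrow> x = \<top>"
  by (simp add: ennpowr_def)

lemma two_pi_power_ge_1: "1 \<le> (2 * pi) ^ n"
  using pi_ge_two by (intro one_le_power) linarith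

lemma continuous_on_norm_powr:
  assumes "continuous_on S f" "0 < a"
  shows "continuous_on S (\<lambda>x. norm (f x) powr a)"
  using assms by (intro continuous_on_powr' continuous_intros) auto

lemma Lp_norm_eq:
  fixes f :: "real ^ 'd::finite \<Rightarrow> complex"
  assumes f: "continuous_on UNIV f" and p: "1 \<le> p" "p < \<infinity>"
  shows "Lp_norm p f = ennreal ((LINT x|torus_measure. norm (f x) powr enn2real p) powr (1 / enn2real p))"
proof -
  have "integrable torus_measure (\<lambda>x. norm (f x) powr enn2real p)"
    using one_le_enn2real[OF p] by (intro integrable_torus_continuous continuous_on_norm_powr f) simp
  then have "(\<integral>\<^sup>+ x. ennreal (norm (f x) powr enn2real p) \<partial>torus_measure)
      = ennreal (LINT x|torus_measure. norm (f x) powr enn2real p)"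
    by (intro nn_integral_eq_integral) auto
  then show ?thesis
    using p by (simp add: Lp_norm_def ennpowr_ennreal integral_nonneg_AE)
qed

lemma enn2real_Lp_norm_eq:
  fixes f :: "real ^ 'd::finite \<Rightarrow> complex"
  assumes "continuous_on UNIV f" "1 \<le> p" "p < \<infinity>"
  shows "enn2real (Lp_norm p f) = (LINT x|torus_measure. norm (f x) powr enn2real p) powr (1 / enn2real p)"
  by (simp add: Lp_norm_eq[OF assms])

lemma borel_measurable_torus_continuous:
  fixes f :: "real ^ 'd::finite \<Rightarrow> 'b::topological_space"
  assumes "continuous_on UNIV f"
  shows "f \<in> borel_measurable torus_measure"
proof -
  have "f \<in> borel_measurable borel" by (rule borel_measurable_continuous_onI[OF assms])
  then show ?thesis by (simp add: measurable_restrict_space1)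
qed

text \<open>
  The factor is the volume of the torus. It is at least \<open>1\<close>, so it dominates its own power
  \<open>1 / p\<close> and can serve all exponents at once.
\<close>

lemma Lp_norm_le_sup:
  fixes f :: "real ^ 'd::finite \<Rightarrow> complex"
  assumes f: "continuous_on UNIV f" and p: "1 \<le> p" and B: "\<And>x. norm (f x) \<le> B"
  shows "Lp_norm p f \<le> ennreal ((2 * pi) ^ CARD('d) * B)"
proof -
  let ?D = "(2 * pi) ^ CARD('d) :: real"
  have D: "1 \<le> ?D" by (rule two_pi_power_ge_1)
  have B0: "0 \<le> B" using B[of 0] norm_ge_zero order_trans by blast
  have BD: "B \<le> ?D * B" using mult_right_mono[OF D B0] by simp
  show ?thesis
  proof (cases "p = \<infinity>")
    case True
    have [measurable]: "f \<in> borel_measurable torus_measure"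
      by (rule borel_measurable_torus_continuous[OF f])
    have "esssup torus_measure (\<lambda>x. ennreal (norm (f x))) \<le> ennreal (?D * B)"
      using order_trans[OF B BD] by (intro esssup_I) (auto intro!: ennreal_leI)
    then show ?thesis using True by (simp add: Lp_norm_def)
  next
    case False
    then have p': "p < \<infinity>" by (simp add: less_top)
    let ?P = "enn2real p"
    have P: "1 \<le> ?P" by (rule one_le_enn2real[OF p p'])
    have "(LINT x|torus_measure. norm (f x) powr ?P) \<le> (LINT x|(torus_measure :: (real^'d) measure). B powr ?P)"
      using P B by (intro integral_mono integrable_torus_continuous continuous_on_norm_powr f continuous_intros powr_mono2) auto
    also have "\<dots> = ?D * B powr ?P" by (simp add: measure_torus)
    finally have "(LINT x|torus_measure. norm (f x) powr ?P) powr (1 / ?P) \<le> (?D * B powr ?P) powr (1 / ?P)"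
      using P by (intro powr_mono2 integral_nonneg_AE) auto
    also have "\<dots> = ?D powr (1 / ?P) * B"
      using P B0 by (simp add: powr_mult powr_powr)
    also have "\<dots> \<le> ?D powr 1 * B"
      using P B0 D by (intro mult_right_mono powr_mono) auto
    also have "\<dots> = ?D * B" using D by simp
    finally show ?thesis unfolding Lp_norm_eq[OF f p p'] by (rule ennreal_leI)
  qed
qed

text \<open>
  Follows by integrating \<open>t powr p \<le> 1 + t ^ (2 m)\<close> for \<open>t = \<bar>f\<bar> / \<sigma>\<close>.
\<close>

lemma Lp_norm_moment_upper:
  fixes f :: "real ^ 'd::finite \<Rightarrow> complex"
  assumes f: "continuous_on UNIV f" and p: "1 \<le> p" "p < \<infinity>" and \<sigma>: "0 < \<sigma>"
    and m: "enn2real p \<le> real (2 * m)"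
  shows "enn2real (Lp_norm p f)
    \<le> \<sigma> * ((2 * pi) ^ CARD('d) + (LINT x|torus_measure. (norm (f x) / \<sigma>) ^ (2 * m))) powr (1 / enn2real p)"
proof -
  let ?P = "enn2real p" and ?D = "(2 * pi) ^ CARD('d) :: real"
  have P: "1 \<le> ?P" by (rule one_le_enn2real[OF p])
  have pt: "norm (f x) powr ?P \<le> \<sigma> powr ?P * (1 + (norm (f x) / \<sigma>) ^ (2 * m))" for x
  proof -
    define t where "t = norm (f x) / \<sigma>"
    have t: "0 \<le> t" "norm (f x) = \<sigma> * t" using \<sigma> by (simp_all add: t_def)
    have "t powr ?P \<le> 1 + t ^ (2 * m)"
    proof (cases "t \<le> 1")
      case True
      then have "t powr ?P \<le> 1" using t P by (intro powr_le1) auto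
      then show ?thesis using t by (simp add: add_increasing2)
    next
      case False
      then have "t powr ?P \<le> t powr real (2 * m)" using m by (intro powr_mono) auto
      also have "\<dots> = t ^ (2 * m)" using False by (intro powr_realpow) auto
      finally show ?thesis by simp
    qed
    then show ?thesis
      using \<sigma> t by (simp add: powr_mult flip: t_def)
  qed
  have i: "integrable torus_measure (\<lambda>x. (norm (f x) / \<sigma>) ^ (2 * m))"
    using \<sigma> by (intro integrable_torus_continuous continuous_intros f) auto
  have j: "integrable (torus_measure :: (real^'d) measure) (\<lambda>x. 1 :: real)"
    by (intro integrable_torus_continuous continuous_intros)
  have "(LINT x|torus_measure. norm (f x) powr ?P)
      \<le> (LINT x|torus_measure. \<sigma> powr ?P * (1 + (norm (f x) / \<sigma>) ^ (2 * m)))"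
    using P \<sigma> pt by (intro integral_mono integrable_torus_continuous continuous_on_norm_powr f continuous_intros) auto
  also have "\<dots> = \<sigma> powr ?P * (?D + (LINT x|torus_measure. (norm (f x) / \<sigma>) ^ (2 * m)))"
    using i j by (simp add: measure_torus)
  finally have "(LINT x|torus_measure. norm (f x) powr ?P) powr (1 / ?P)
      \<le> (\<sigma> powr ?P * (?D + (LINT x|torus_measure. (norm (f x) / \<sigma>) ^ (2 * m)))) powr (1 / ?P)"
    using P by (intro powr_mono2 integral_nonneg_AE) auto
  also have "\<dots> = \<sigma> * (?D + (LINT x|torus_measure. (norm (f x) / \<sigma>) ^ (2 * m))) powr (1 / ?P)"
    using P \<sigma> by (simp add: powr_mult powr_powr add_nonneg_nonneg integral_nonneg_AE)
  finally show ?thesis unfolding enn2real_Lp_norm_eq[OF f p] .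
qed

definition Lp_lower_const :: "nat \<Rightarrow> real \<Rightarrow> real" where
  "Lp_lower_const d P = ((2 * pi) ^ d / (5 * 2 powr (P + 2))) powr (1 / P)"

lemma Lp_lower_const_pos: "0 < Lp_lower_const d P"
  by (simp add: Lp_lower_const_def)

text \<open>
  The first term covers small values of \<open>t\<close>, the last one large values, and the middle one those
  between \<open>1/2\<close> and \<open>2\<close>. The coefficients \<open>1/4\<close> are chosen so small that for a complex Gaussian
  variable, with second moment \<open>1\<close> and fourth moment \<open>2\<close>, the outer terms have mean
  \<open>1/4 + 1/2 < 1\<close>.
\<close>

lemma square_le_powr_plus_fourth:
  assumes "0 \<le> t" "0 < P"
  shows "t\<^sup>2 \<le> 1 / 4 + 2 powr (P + 2) * t powr P + t ^ 4 / (4 :: real)"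
proof -
  consider "t \<le> 1 / 2" | "1 / 2 < t" "t \<le> 2" | "2 < t" by linarith
  then show ?thesis
  proof cases
    case 1
    then have "t\<^sup>2 \<le> (1 / 2)\<^sup>2" using assms by (intro power_mono) auto
    then have "t\<^sup>2 \<le> 1 / 4" by (simp add: power_divide)
    moreover have "0 \<le> 2 powr (P + 2) * t powr P + t ^ 4 / 4" by simp
    ultimately show ?thesis by linarith
  next
    case 2
    have "t\<^sup>2 \<le> 2\<^sup>2" using 2 by (intro power_mono) auto
    then have "t\<^sup>2 \<le> 4" by simp
    moreover have "1 \<le> (2 * t) powr P" using 2 assms by (intro ge_one_powr_ge_zero) auto
    moreover have "2 powr (P + 2) * t powr P = 4 * (2 * t) powr P"
      using 2 by (simp add: powr_add powr_mult)
    moreover have "0 \<le> t ^ 4 / 4" by simp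
    ultimately show ?thesis by linarith
  next
    case 3
    have "t\<^sup>2 * 2\<^sup>2 \<le> t\<^sup>2 * t\<^sup>2" using 3 by (intro mult_left_mono power_mono) auto
    then have "t\<^sup>2 \<le> t ^ 4 / 4" by (simp flip: power_add)
    moreover have "0 \<le> 2 powr (P + 2) * t powr P" by simp
    ultimately show ?thesis by linarith
  qed
qed

text \<open>
  Integrating \<open>square_le_powr_plus_fourth\<close> for \<open>t = \<bar>f\<bar> / \<sigma>\<close> leaves a positive lower bound for the
  moment of order \<open>p\<close>. The limiting value of the right-hand side of the hypothesis is a quarter of
  the volume of the torus; a fifth is demanded.
\<close>

lemma Lp_norm_moment_lower:
  fixes f :: "real ^ 'd::finite \<Rightarrow> complex"
  assumes f: "continuous_on UNIV f" and p: "1 \<le> p" "p < \<infinity>" and \<sigma>: "0 < \<sigma>"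
    and I: "(2 * pi) ^ CARD('d) / 5 \<le> (LINT x|torus_measure. (norm (f x) / \<sigma>)\<^sup>2)
      - (2 * pi) ^ CARD('d) / 4 - (LINT x|torus_measure. (norm (f x) / \<sigma>) ^ 4) / 4"
  shows "\<sigma> * Lp_lower_const CARD('d) (enn2real p) \<le> enn2real (Lp_norm p f)"
proof -
  let ?P = "enn2real p" and ?D = "(2 * pi) ^ CARD('d) :: real"
  let ?J = "LINT x|torus_measure. (norm (f x) / \<sigma>) powr ?P"
  have P: "1 \<le> ?P" by (rule one_le_enn2real[OF p])
  have cont: "continuous_on UNIV (\<lambda>x. norm (f x) / \<sigma>)" using \<sigma> by (intro continuous_intros f) auto
  have contP: "continuous_on UNIV (\<lambda>x. (norm (f x) / \<sigma>) powr ?P)"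
    using P \<sigma> by (intro continuous_on_powr'[OF cont] continuous_intros) auto
  have i: "integrable torus_measure (\<lambda>x. (norm (f x) / \<sigma>)\<^sup>2)"
      "integrable torus_measure (\<lambda>x. (norm (f x) / \<sigma>) ^ 4)"
      "integrable torus_measure (\<lambda>x. (norm (f x) / \<sigma>) powr ?P)"
      "integrable (torus_measure :: (real^'d) measure) (\<lambda>x. 1 / 4 :: real)"
    by (intro integrable_torus_continuous contP continuous_intros cont)+
  have "(LINT x|torus_measure. (norm (f x) / \<sigma>)\<^sup>2)
      \<le> (LINT x|torus_measure. 1 / 4 + 2 powr (?P + 2) * (norm (f x) / \<sigma>) powr ?P + (norm (f x) / \<sigma>) ^ 4 / 4)"
    using P \<sigma> i by (intro integral_mono square_le_powr_plus_fourth) auto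
  also have "\<dots> = ?D / 4 + 2 powr (?P + 2) * ?J + (LINT x|torus_measure. (norm (f x) / \<sigma>) ^ 4) / 4"
    using i by (simp add: measure_torus)
  finally have "?D / 5 \<le> 2 powr (?P + 2) * ?J" using I by linarith
  then have J: "?D / (5 * 2 powr (?P + 2)) \<le> ?J" by (simp add: field_simps)
  have "\<sigma> * Lp_lower_const CARD('d) ?P \<le> \<sigma> * ?J powr (1 / ?P)"
    unfolding Lp_lower_const_def using P \<sigma> J by (intro mult_left_mono powr_mono2) auto
  also have "\<dots> = (\<sigma> powr ?P * ?J) powr (1 / ?P)"
    using P \<sigma> by (simp add: powr_mult powr_powr integral_nonneg_AE)
  also have "\<sigma> powr ?P * ?J = (LINT x|torus_measure. norm (f x) powr ?P)"
  proof -
    have "\<sigma> powr ?P * (norm (f x) / \<sigma>) powr ?P = norm (f x) powr ?P" for x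
      using \<sigma> by (simp add: powr_divide)
    then show ?thesis
      by (simp only: Bochner_Integration.integral_mult_right_zero[symmetric])
  qed
  finally show ?thesis unfolding enn2real_Lp_norm_eq[OF f p] .
qed

lemma Linf_norm_moment_lower:
  fixes f :: "real ^ 'd::finite \<Rightarrow> complex"
  assumes f: "continuous_on UNIV f" and fin: "Lp_norm \<infinity> f < \<infinity>" and \<sigma>: "0 < \<sigma>"
  shows "(LINT x|torus_measure. (norm (f x) / \<sigma>) ^ n) \<le> (2 * pi) ^ CARD('d) * (enn2real (Lp_norm \<infinity> f) / \<sigma>) ^ n"
proof -
  let ?B = "enn2real (Lp_norm \<infinity> f)"
  have eq: "Lp_norm \<infinity> f = ennreal ?B" using fin by (simp add: less_top)
  have "AE x in torus_measure. ennreal (norm (f x)) \<le> ennreal ?B"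
    using esssup_AE[of "\<lambda>x. ennreal (norm (f x))" torus_measure] unfolding eq[symmetric] by (simp add: Lp_norm_def)
  then have "AE x in torus_measure. (norm (f x) / \<sigma>) ^ n \<le> (?B / \<sigma>) ^ n"
    by eventually_elim (use \<sigma> in \<open>auto intro!: power_mono divide_right_mono\<close>)
  then have "(LINT x|torus_measure. (norm (f x) / \<sigma>) ^ n) \<le> (LINT x|(torus_measure :: (real^'d) measure). (?B / \<sigma>) ^ n)"
    using \<sigma> by (intro integral_mono_AE integrable_torus_continuous continuous_intros f) auto
  then show ?thesis by (simp add: measure_torus)
qed

section \<open>Besov norms and block sequences\<close>

lemma noise_series_bounded: "\<exists>B. \<forall>x. norm (noise_series K b u x) \<le> B"
proof (intro exI allI)
  fix x
  show "norm (noise_series K b u x) \<le> (\<Sum>k\<in>K. \<bar>b k\<bar> * norm (u (character (- k))))"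
    unfolding noise_series_def by (rule order_trans[OF norm_sum]) (simp add: norm_mult)
qed

lemma continuous_on_lp_block: "continuous_on S (lp_block \<phi> j u)"
  unfolding lp_block_eq_noise_series by (rule continuous_on_noise_series)

lemma Lp_norm_lp_block_finite:
  assumes "1 \<le> p"
  shows "Lp_norm p (lp_block \<phi> j u) < \<infinity>"
proof -
  obtain B where "\<And>x. norm (lp_block \<phi> j u x) \<le> B"
    unfolding lp_block_eq_noise_series using noise_series_bounded by blast
  from Lp_norm_le_sup[OF continuous_on_lp_block assms this] show ?thesis
    using le_less_trans by fastforce
qed

text \<open>
  The Besov norm with parameter \<open>q\<close> is the \<open>\<ell>\<^sup>q\<close> norm of this sequence. The terms are real numbers because
  the blocks are bounded functions.
\<close>

definition besov_terms ::
    "(real ^ 'd::finite \<Rightarrow> real) \<Rightarrow> real \<Rightarrow> ennreal \<Rightarrow> ((real ^ 'd \<Rightarrow> complex) \<Rightarrow> complex) \<Rightarrow> nat \<Rightarrow> real" where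
  "besov_terms \<phi> s p u j = 2 powr (s * real j) * enn2real (Lp_norm p (lp_block \<phi> j u))"

lemma besov_terms_nonneg: "0 \<le> besov_terms \<phi> s p u j"
  by (simp add: besov_terms_def)

lemma besov_norm_infinity:
  assumes "1 \<le> p"
  shows "besov_norm \<phi> s p \<infinity> u = (SUP j. ennreal (besov_terms \<phi> s p u j))"
  using Lp_norm_lp_block_finite[OF assms, of \<phi> _ u]
  by (simp add: besov_norm_def besov_terms_def ennreal_mult less_top)

lemma besov_norm_finite_iff_summable:
  assumes p: "1 \<le> p" and q: "1 \<le> q" "q < \<infinity>"
  shows "besov_norm \<phi> s p q u < \<infinity> \<longleftrightarrow> summable (\<lambda>j. besov_terms \<phi> s p u j powr enn2real q)"
proof -
  let ?y = "\<lambda>j. besov_terms \<phi> s p u j powr enn2real q"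
  have "ennreal (2 powr (s * real j * enn2real q)) * ennpowr (Lp_norm p (lp_block \<phi> j u)) (enn2real q)
      = ennreal (?y j)" for j
    using Lp_norm_lp_block_finite[OF p, of \<phi> j u]
    by (simp add: besov_terms_def ennpowr_def powr_mult powr_powr ennreal_mult less_top)
  moreover have "q \<noteq> \<infinity>" using q(2) by auto
  ultimately have "besov_norm \<phi> s p q u = ennpowr (\<Sum>j. ennreal (?y j)) (1 / enn2real q)"
    by (simp only: besov_norm_def if_False)
  then have "besov_norm \<phi> s p q u < \<infinity> \<longleftrightarrow> (\<Sum>j. ennreal (?y j)) < \<infinity>"
    by (simp only: infinity_ennreal_def less_top[symmetric] ennpowr_eq_top_iff)
  also have "\<dots> \<longleftrightarrow> summable ?y"
    unfolding infinity_ennreal_def less_top[symmetric]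
    by (rule iffI, rule summable_suminf_not_top, simp_all add: ennreal_suminf_neq_top)
  finally show ?thesis .
qed

lemma besov_norm_finite_if_bounded:
  assumes "1 \<le> p" "eventually (\<lambda>j. besov_terms \<phi> s p u j \<le> C) sequentially"
  shows "besov_norm \<phi> s p \<infinity> u < \<infinity>"
proof -
  have "Bseq (besov_terms \<phi> s p u)"
    using assms(2) by (intro BfunI[of _ C]) (auto elim!: eventually_mono simp: besov_terms_nonneg)
  then obtain B where "\<And>j. norm (besov_terms \<phi> s p u j) \<le> B" unfolding Bseq_def by blast
  then have "besov_terms \<phi> s p u j \<le> B" for j by (metis abs_le_D1 real_norm_def)
  then have "(SUP j. ennreal (besov_terms \<phi> s p u j)) \<le> ennreal B"
    by (intro SUP_least ennreal_leI)
  then show ?thesis unfolding besov_norm_infinity[OF assms(1)] using le_less_trans by fastforce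
qed

lemma besov_norm_finite_if_geometric:
  assumes p: "1 \<le> p" and q: "1 \<le> q" and \<rho>: "0 \<le> \<rho>" "\<rho> < 1" and C: "0 \<le> C"
    and ev: "eventually (\<lambda>j. besov_terms \<phi> s p u j \<le> C * \<rho> ^ j) sequentially"
  shows "besov_norm \<phi> s p q u < \<infinity>"
proof (cases "q = \<infinity>")
  case True
  have "eventually (\<lambda>j. besov_terms \<phi> s p u j \<le> C) sequentially"
    using ev
  proof eventually_elim
    case (elim j)
    have "C * \<rho> ^ j \<le> C * 1" using C \<rho> by (intro mult_left_mono power_le_one) auto
    then show ?case using elim by simp
  qed
  then show ?thesis using besov_norm_finite_if_bounded[OF p] True by simp
next
  case False
  then have q': "q < \<infinity>" by (simp add: less_top)
  let ?Q = "enn2real q"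
  have Q: "1 \<le> ?Q" by (rule one_le_enn2real[OF q q'])
  have "summable (\<lambda>j. besov_terms \<phi> s p u j powr ?Q)"
  proof (rule summable_comparison_test_ev)
    have "\<rho> powr ?Q < 1"
      using \<rho> Q powr_less_mono2[of ?Q \<rho> 1] by simp
    then show "summable (\<lambda>j. C powr ?Q * (\<rho> powr ?Q) ^ j)"
      by (intro summable_mult summable_geometric) simp
    show "eventually (\<lambda>j. norm (besov_terms \<phi> s p u j powr ?Q) \<le> C powr ?Q * (\<rho> powr ?Q) ^ j) sequentially"
      using ev
    proof eventually_elim
      case (elim j)
      have "besov_terms \<phi> s p u j powr ?Q \<le> (C * \<rho> ^ j) powr ?Q"
        using Q elim by (intro powr_mono2 besov_terms_nonneg) auto
      also have "\<dots> = C powr ?Q * (\<rho> ^ j) powr ?Q" using C \<rho> by (simp add: powr_mult)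
      also have "(\<rho> ^ j) powr ?Q = (\<rho> powr ?Q) ^ j"
        using \<rho> by (induction j) (simp_all add: powr_mult)
      finally show ?case by simp
    qed
  qed
  then show ?thesis using besov_norm_finite_iff_summable[OF p q q'] by blast
qed

lemma besov_norm_infinite_if_lower:
  assumes p: "1 \<le> p" and q: "1 \<le> q" "q < \<infinity>" and c: "0 < c"
    and ev: "eventually (\<lambda>j. c \<le> besov_terms \<phi> s p u j) sequentially"
  shows "\<not> besov_norm \<phi> s p q u < \<infinity>"
proof
  assume "besov_norm \<phi> s p q u < \<infinity>"
  then have "(\<lambda>j. besov_terms \<phi> s p u j powr enn2real q) \<longlonglongrightarrow> 0"
    using besov_norm_finite_iff_summable[OF p q] summable_LIMSEQ_zero by blast
  moreover have "0 < c powr enn2real q" using c by simp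
  ultimately have "eventually (\<lambda>j. besov_terms \<phi> s p u j powr enn2real q < c powr enn2real q) sequentially"
    by (rule order_tendstoD(2))
  with ev have "eventually (\<lambda>j. False) sequentially"
  proof eventually_elim
    case (elim j)
    then show ?case
      using powr_mono2[of "enn2real q" c "besov_terms \<phi> s p u j"] c by simp
  qed
  then show False by simp
qed

lemma besov_norm_infinite_if_unbounded:
  assumes p: "1 \<le> p" and q: "1 \<le> q" and lim: "filterlim (besov_terms \<phi> s p u) at_top sequentially"
  shows "\<not> besov_norm \<phi> s p q u < \<infinity>"
proof (cases "q = \<infinity>")
  case False
  then show ?thesis
    using besov_norm_infinite_if_lower[OF p q _ zero_less_one] lim
    by (auto simp: filterlim_at_top less_top)
next
  case True
  show ?thesis
  proof
    assume fin: "besov_norm \<phi> s p q u < \<infinity>"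
    then obtain B where B: "besov_norm \<phi> s p \<infinity> u = ennreal B" "0 \<le> B"
      unfolding True by (cases "besov_norm \<phi> s p \<infinity> u") auto
    have "besov_terms \<phi> s p u j \<le> B" for j
    proof -
      have "ennreal (besov_terms \<phi> s p u j) \<le> ennreal B"
        unfolding B(1)[symmetric] besov_norm_infinity[OF p] by (rule SUP_upper) simp
      then show ?thesis using B(2) by simp
    qed
    moreover have "eventually (\<lambda>j. B + 1 \<le> besov_terms \<phi> s p u j) sequentially"
      using lim by (simp add: filterlim_at_top)
    then obtain j where "B + 1 \<le> besov_terms \<phi> s p u j"
      using eventually_happens'[OF sequentially_bot] by blast
    ultimately show False by (smt (verit))
  qed
qed

text \<open>
  The event of probability \<open>1\<close> on which all claims are decided: the normalized blocks have the moments
  of a complex Gaussian variable in the limit.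
\<close>

definition typical_blocks :: "(real ^ 'd::finite \<Rightarrow> real) \<Rightarrow> ((real ^ 'd \<Rightarrow> complex) \<Rightarrow> complex) \<Rightarrow> bool" where
  "typical_blocks \<phi> u \<longleftrightarrow> (\<forall>m. (\<lambda>j. LINT x|torus_measure. (norm (lp_block \<phi> j u x) / block_sd \<phi> j) ^ (2 * m))
     \<longlonglongrightarrow> (2 * pi) ^ CARD('d) * fact m)"

lemma typical_blocksD:
  "typical_blocks \<phi> u \<Longrightarrow> (\<lambda>j. LINT x|torus_measure. (norm (lp_block \<phi> j u x) / block_sd \<phi> j) ^ (2 * m))
     \<longlonglongrightarrow> (2 * pi) ^ CARD('d) * fact m" for \<phi> :: "real ^ 'd::finite \<Rightarrow> real"
  by (simp add: typical_blocks_def)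

lemma typical_blocks_AE:
  assumes "white_noise M W" "dyadic_partition \<phi>"
  shows "AE \<omega> in M. typical_blocks \<phi> (W \<omega>)"
  unfolding typical_blocks_def AE_all_countable using lp_block_moment_tendsto[OF assms] by blast

lemma block_sd_bounds:
  fixes \<phi> :: "real ^ 'd::finite \<Rightarrow> real"
  assumes \<phi>: "dyadic_partition \<phi>"
  shows "\<exists>a b. 0 < a \<and> 0 < b \<and> eventually (\<lambda>j. a \<le> 2 powr (- real CARD('d) / 2 * real j) * block_sd \<phi> j
      \<and> 2 powr (- real CARD('d) / 2 * real j) * block_sd \<phi> j \<le> b) sequentially"
proof -
  let ?D = "(2 * pi) ^ CARD('d) :: real"
  obtain c where c: "c > 0" and ev: "eventually (\<lambda>j. c * 2 ^ (j * CARD('d)) \<le> block_energy \<phi> j) sequentially"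
    using block_energy_lower[OF \<phi>] by blast
  define a b where "a = sqrt (c / ?D)" and "b = sqrt (5 ^ CARD('d) / ?D)"
  have eq: "2 powr (- real CARD('d) / 2 * real j) * block_sd \<phi> j
      = sqrt (block_energy \<phi> j / 2 ^ (j * CARD('d)) / ?D)" for j
  proof -
    let ?N = "j * CARD('d)"
    have "(2 powr (- real CARD('d) / 2 * real j))\<^sup>2 = 2 powr (- real ?N)"
      unfolding power2_eq_square powr_add[symmetric] by (intro arg_cong2[where f = "(powr)"]) simp_all
    also have "\<dots> = 1 / 2 ^ ?N"
      by (simp only: powr_minus powr_realpow[OF zero_less_numeral] inverse_eq_divide)
    finally have "2 powr (- real CARD('d) / 2 * real j) = sqrt (1 / 2 ^ ?N)"
      by (intro real_sqrt_unique[symmetric]) auto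
    then show ?thesis
      unfolding block_sd_def by (simp only: real_sqrt_mult[symmetric]) simp
  qed
  have "eventually (\<lambda>j. a \<le> 2 powr (- real CARD('d) / 2 * real j) * block_sd \<phi> j
      \<and> 2 powr (- real CARD('d) / 2 * real j) * block_sd \<phi> j \<le> b) sequentially"
    using ev eventually_gt_at_top[of 0]
  proof eventually_elim
    case (elim j)
    have "c \<le> block_energy \<phi> j / 2 ^ (j * CARD('d))" using elim(1) by (simp add: pos_le_divide_eq)
    moreover have "block_energy \<phi> j / 2 ^ (j * CARD('d)) \<le> 5 ^ CARD('d)"
      using block_energy_upper[OF \<phi> elim(2)] by (simp add: pos_divide_le_eq)
    ultimately show ?case
      unfolding eq a_def b_def by (intro conjI real_sqrt_le_mono divide_right_mono) auto
  qed
  moreover have "0 < a" "0 < b" using c by (auto simp: a_def b_def)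
  ultimately show ?thesis by blast
qed

lemma block_sd_pos:
  assumes "dyadic_partition \<phi>"
  shows "eventually (\<lambda>j. 0 < block_sd \<phi> j) sequentially"
proof -
  obtain a b where "0 < a" "eventually (\<lambda>j. a \<le> 2 powr (- real CARD('a) / 2 * real j) * block_sd \<phi> j
      \<and> 2 powr (- real CARD('a) / 2 * real j) * block_sd \<phi> j \<le> b) sequentially"
    using block_sd_bounds[OF assms] by blast
  from this(2) show ?thesis
  proof eventually_elim
    case (elim j)
    then have "0 < 2 powr (- real CARD('a) / 2 * real j) * block_sd \<phi> j" using \<open>0 < a\<close> by linarith
    then show ?case by (simp add: zero_less_mult_iff)
  qed
qed

section \<open>Besov regularity of a distribution with typical blocks\<close>

lemma block_Lp_upper:
  fixes \<phi> :: "real ^ 'd::finite \<Rightarrow> real"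
  assumes \<phi>: "dyadic_partition \<phi>" and u: "typical_blocks \<phi> u" and p: "1 \<le> p" "p < \<infinity>"
  shows "\<exists>C\<ge>0. eventually (\<lambda>j. enn2real (Lp_norm p (lp_block \<phi> j u)) \<le> C * block_sd \<phi> j) sequentially"
proof -
  let ?D = "(2 * pi) ^ CARD('d) :: real" and ?P = "enn2real p"
  obtain m where m: "?P \<le> real (2 * m)"
    using real_arch_simple[of ?P] by (metis le_add_same_cancel1 mult_2 of_nat_le_iff order_trans zero_le)
  let ?I = "\<lambda>j. LINT x|torus_measure. (norm (lp_block \<phi> j u x) / block_sd \<phi> j) ^ (2 * m)"
  have "eventually (\<lambda>j. ?I j < ?D * fact m + 1) sequentially"
    using typical_blocksD[OF u] by (rule order_tendstoD(2)) simp
  then have "eventually (\<lambda>j. enn2real (Lp_norm p (lp_block \<phi> j u))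
      \<le> (?D + (?D * fact m + 1)) powr (1 / ?P) * block_sd \<phi> j) sequentially"
    using block_sd_pos[OF \<phi>]
  proof eventually_elim
    case (elim j)
    have "0 \<le> ?I j" using elim(2) by (intro integral_nonneg_AE) auto
    then have "(?D + ?I j) powr (1 / ?P) \<le> (?D + (?D * fact m + 1)) powr (1 / ?P)"
      using elim(1) one_le_enn2real[OF p] by (intro powr_mono2 add_nonneg_nonneg) auto
    then have "block_sd \<phi> j * (?D + ?I j) powr (1 / ?P) \<le> (?D + (?D * fact m + 1)) powr (1 / ?P) * block_sd \<phi> j"
      using elim(2) by (simp add: mult.commute)
    then show ?case
      using Lp_norm_moment_upper[OF continuous_on_lp_block p elim(2) m, of \<phi> j u] by linarith
  qed
  then show ?thesis by (intro exI[of _ "(?D + (?D * fact m + 1)) powr (1 / ?P)"]) simp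
qed

lemma block_Lp_lower:
  fixes \<phi> :: "real ^ 'd::finite \<Rightarrow> real"
  assumes \<phi>: "dyadic_partition \<phi>" and u: "typical_blocks \<phi> u" and p: "1 \<le> p" "p < \<infinity>"
  shows "eventually (\<lambda>j. Lp_lower_const CARD('d) (enn2real p) * block_sd \<phi> j
           \<le> enn2real (Lp_norm p (lp_block \<phi> j u))) sequentially"
proof -
  let ?D = "(2 * pi) ^ CARD('d) :: real"
  let ?I = "\<lambda>n j. LINT x|torus_measure. (norm (lp_block \<phi> j u x) / block_sd \<phi> j) ^ n"
  have "(\<lambda>j. ?I 2 j - ?D / 4 - ?I 4 j / 4) \<longlonglongrightarrow> ?D - ?D / 4 - (?D * 2) / 4"
    using typical_blocksD[OF u, of 1] typical_blocksD[OF u, of 2] by (intro tendsto_intros) simp_all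
  then have "eventually (\<lambda>j. ?D / 5 < ?I 2 j - ?D / 4 - ?I 4 j / 4) sequentially"
    by (rule order_tendstoD(1)) simp
  with block_sd_pos[OF \<phi>] show ?thesis
  proof eventually_elim
    case (elim j)
    show ?case
      using Lp_norm_moment_lower[OF continuous_on_lp_block p elim(1), of \<phi> j u] elim(2)
      by (simp add: mult.commute)
  qed
qed

text \<open>
  If the sup norm stayed below \<open>B \<sigma>\<^sub>j\<close>, the moment of order \<open>2 m\<close> would be at most the volume times
  \<open>B ^ (2 m)\<close>. This contradicts its limit once \<open>m\<close> is so large that \<open>m!\<close> exceeds \<open>B ^ (2 m)\<close>.
\<close>

lemma block_Linf_growth:
  fixes \<phi> :: "real ^ 'd::finite \<Rightarrow> real"
  assumes \<phi>: "dyadic_partition \<phi>" and u: "typical_blocks \<phi> u" and B: "0 < B"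
  shows "eventually (\<lambda>j. B * block_sd \<phi> j \<le> enn2real (Lp_norm \<infinity> (lp_block \<phi> j u))) sequentially"
proof -
  let ?D = "(2 * pi) ^ CARD('d) :: real"
  have "(\<lambda>m. inverse (fact m) * (B\<^sup>2) ^ m) \<longlonglongrightarrow> 0"
    by (rule summable_LIMSEQ_zero) (rule summable_exp)
  then have "eventually (\<lambda>m. inverse (fact m) * (B\<^sup>2) ^ m < 1) sequentially"
    by (rule order_tendstoD(2)) simp
  then obtain m where "inverse (fact m) * (B\<^sup>2) ^ m < 1"
    using eventually_happens'[OF sequentially_bot] by blast
  then have m: "B ^ (2 * m) < fact m" unfolding power_mult by (simp add: field_simps)
  have "eventually (\<lambda>j. ?D * B ^ (2 * m) < (LINT x|torus_measure. (norm (lp_block \<phi> j u x) / block_sd \<phi> j) ^ (2 * m))) sequentially"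
    using typical_blocksD[OF u, of m] by (rule order_tendstoD(1)) (use m in simp)
  with block_sd_pos[OF \<phi>] show ?thesis
  proof eventually_elim
    case (elim j)
    let ?x = "enn2real (Lp_norm \<infinity> (lp_block \<phi> j u))"
    have "?D * B ^ (2 * m) < ?D * (?x / block_sd \<phi> j) ^ (2 * m)"
      by (rule less_le_trans[OF elim(2) Linf_norm_moment_lower[OF continuous_on_lp_block Lp_norm_lp_block_finite elim(1)]])
        simp
    then have "B ^ (2 * m) < (?x / block_sd \<phi> j) ^ (2 * m)" by simp
    then have "B < ?x / block_sd \<phi> j"
      by (rule power_less_imp_less_base) (use elim(1) in simp)
    then show ?case using elim(1) by (simp add: pos_less_divide_eq)
  qed
qed

lemma block_Lp_lower_all:
  fixes \<phi> :: "real ^ 'd::finite \<Rightarrow> real"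
  assumes "dyadic_partition \<phi>" "typical_blocks \<phi> u" "1 \<le> p"
  shows "\<exists>c>0. eventually (\<lambda>j. c * block_sd \<phi> j \<le> enn2real (Lp_norm p (lp_block \<phi> j u))) sequentially"
proof (cases "p = \<infinity>")
  case True
  then show ?thesis using block_Linf_growth[OF assms(1,2) zero_less_one] zero_less_one by blast
next
  case False
  then show ?thesis using block_Lp_lower[OF assms] Lp_lower_const_pos by (auto simp: less_top)
qed

lemma lp_block_in_trig_polys:
  fixes \<phi> :: "real ^ 'd::finite \<Rightarrow> real"
  assumes "dyadic_partition \<phi>" "0 < j"
  shows "lp_block \<phi> j u \<in> trig_polys (2 * 2 ^ j)"
proof -
  have "(\<lambda>x. (complex_of_real (lp_cutoff \<phi> j (freq k) / (2 * pi) ^ CARD('d)) * u (character (- k))) * character k x)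
      \<in> trig_polys (2 * 2 ^ j)" if "k \<in> block_freqs \<phi> j" for k
    using block_freqs_subset_cube[OF assms] that by (intro trig_polys_scaled_character) auto
  from trig_polys_sum[of "block_freqs \<phi> j", OF this] show ?thesis
    unfolding lp_block_eq_noise_series noise_series_def[abs_def] by (simp add: mult_ac)
qed

text \<open>
  The Nikolskii inequality applies with degree \<open>2 * 2 ^ j\<close>, and \<open>m\<close> is chosen so large that the loss
  \<open>d / (2 m)\<close> is at most \<open>\<epsilon>\<close>. The uniform bound then controls every exponent \<open>p\<close>.
\<close>

lemma block_sup_upper:
  fixes \<phi> :: "real ^ 'd::finite \<Rightarrow> real"
  assumes \<phi>: "dyadic_partition \<phi>" and u: "typical_blocks \<phi> u" and p: "1 \<le> p" and \<epsilon>: "0 < \<epsilon>"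
  shows "\<exists>C\<ge>0. eventually (\<lambda>j. enn2real (Lp_norm p (lp_block \<phi> j u))
           \<le> C * 2 powr (\<epsilon> * real j) * block_sd \<phi> j) sequentially"
proof -
  let ?D = "(2 * pi) ^ CARD('d) :: real"
  obtain m :: nat where m: "real CARD('d) / (2 * \<epsilon>) < real m" using reals_Archimedean2 by blast
  have "0 < real CARD('d) / (2 * \<epsilon>)" using \<epsilon> by simp
  then have m0: "0 < m" using m by (metis less_trans of_nat_0_less_iff)
  have m\<epsilon>: "real CARD('d) / (2 * real m) \<le> \<epsilon>"
    using m \<epsilon> m0 by (simp add: field_simps)
  \<comment> \<open>The first factor is the part independent of \<open>j\<close> in the Nikolskii constant for degree
    \<open>2 * 2 ^ j\<close>; the second one bounds the normalized moment of order \<open>2 m\<close> for large \<open>j\<close>.\<close>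
  define A where "A = (5 * real m) ^ CARD('d) * (?D * fact m + 1)"
  have A: "0 \<le> A" by (simp add: A_def)
  define C where "C = ?D * A powr (1 / (2 * real m))"
  let ?I = "\<lambda>j. LINT x|torus_measure. (norm (lp_block \<phi> j u x) / block_sd \<phi> j) ^ (2 * m)"
  have "eventually (\<lambda>j. ?I j < ?D * fact m + 1) sequentially"
    using typical_blocksD[OF u] by (rule order_tendstoD(2)) simp
  then have "eventually (\<lambda>j. enn2real (Lp_norm p (lp_block \<phi> j u))
           \<le> C * 2 powr (\<epsilon> * real j) * block_sd \<phi> j) sequentially"
    using block_sd_pos[OF \<phi>] eventually_gt_at_top[of 0]
  proof eventually_elim
    case (elim j)
    let ?\<sigma> = "block_sd \<phi> j"
    define B where "B = A powr (1 / (2 * real m)) * 2 powr (\<epsilon> * real j) * ?\<sigma>"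
    have B0: "0 \<le> B" using elim(2) by (simp add: B_def)
    have "norm (lp_block \<phi> j u x) \<le> B" for x
    proof (rule power_le_imp_le_base)
      have "?I j \<ge> 0" using elim(2) by (intro integral_nonneg_AE) auto
      have "(LINT x|torus_measure. norm (lp_block \<phi> j u x) ^ (2 * m)) = ?\<sigma> ^ (2 * m) * ?I j"
        using elim(2) by (simp add: power_divide)
      moreover have "((2 * real (m * (2 * 2 ^ j)) + 1) / (2 * pi)) ^ CARD('d) \<le> (5 * real m * 2 ^ j) ^ CARD('d)"
      proof (rule power_mono)
        have "1 * 1 \<le> real m * 2 ^ j" using m0 by (intro mult_mono) auto
        then have le: "2 * real (m * (2 * 2 ^ j)) + 1 \<le> 5 * real m * 2 ^ j" by simp
        have "(2 * real (m * (2 * 2 ^ j)) + 1) / (2 * pi) \<le> (2 * real (m * (2 * 2 ^ j)) + 1) / 1"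
          using pi_ge_two by (intro divide_left_mono) auto
        also have "\<dots> \<le> 5 * real m * 2 ^ j" unfolding div_by_1 by (rule le)
        finally show "(2 * real (m * (2 * 2 ^ j)) + 1) / (2 * pi) \<le> 5 * real m * 2 ^ j" .
      qed auto
      ultimately have "norm (lp_block \<phi> j u x) ^ (2 * m) \<le> (5 * real m * 2 ^ j) ^ CARD('d) * (?\<sigma> ^ (2 * m) * ?I j)"
        using nikolskii_bound[OF lp_block_in_trig_polys[OF \<phi> elim(3)], of u x m] \<open>?I j \<ge> 0\<close> elim(2)
        by (elim order_trans) (auto intro!: mult_right_mono)
      also have "\<dots> \<le> (5 * real m * 2 ^ j) ^ CARD('d) * (?\<sigma> ^ (2 * m) * (?D * fact m + 1))"
        using elim(1,2) by (intro mult_left_mono) auto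
      also have "\<dots> = A * 2 ^ (j * CARD('d)) * ?\<sigma> ^ (2 * m)"
        by (simp add: A_def power_mult_distrib power_mult mult_ac)
      also have "\<dots> \<le> B ^ (2 * m)"
      proof -
        have "(A powr (1 / (2 * real m))) ^ (2 * m) = A"
          using A m0 by (cases "A = 0") (simp_all add: powr_powr flip: powr_realpow)
        moreover have "2 ^ (j * CARD('d)) \<le> (2 powr (\<epsilon> * real j)) ^ (2 * m)"
        proof -
          have "real CARD('d) \<le> \<epsilon> * (2 * real m)" using m\<epsilon> m0 by (simp add: pos_divide_le_eq)
          then have "real j * real CARD('d) \<le> real j * (\<epsilon> * (2 * real m))" by (intro mult_left_mono) auto
          then have "2 powr (real (j * CARD('d))) \<le> 2 powr (\<epsilon> * real j * real (2 * m))"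
            by (simp add: mult_ac)
          also have "\<dots> = (2 powr (\<epsilon> * real j)) ^ (2 * m)"
            by (simp add: powr_powr flip: powr_realpow)
          finally show ?thesis by (simp only: powr_realpow[OF zero_less_numeral])
        qed
        ultimately show ?thesis
          unfolding B_def power_mult_distrib using A elim(2)
          by (intro mult_right_mono) (auto intro!: mult_left_mono)
      qed
      finally show "norm (lp_block \<phi> j u x) ^ Suc (2 * m - 1) \<le> B ^ Suc (2 * m - 1)"
        using m0 by (simp del: power_Suc)
    qed (rule B0)
    then have "Lp_norm p (lp_block \<phi> j u) \<le> ennreal (?D * B)"
      by (rule Lp_norm_le_sup[OF continuous_on_lp_block p])
    then have "enn2real (Lp_norm p (lp_block \<phi> j u)) \<le> ?D * B"
      using B0 enn2real_leI by simp
    then show ?case by (simp add: C_def B_def mult_ac)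
  qed
  moreover have "0 \<le> C" by (simp add: C_def)
  ultimately show ?thesis by blast
qed

lemma besov_terms_shift:
  "besov_terms \<phi> s p u j = 2 powr ((s + real CARD('d) / 2) * real j)
     * (2 powr (- real CARD('d) / 2 * real j) * enn2real (Lp_norm p (lp_block \<phi> j u)))"
  for \<phi> :: "real ^ 'd::finite \<Rightarrow> real"
  unfolding besov_terms_def mult.assoc[symmetric] powr_add[symmetric] by (simp add: algebra_simps)

lemma typical_besov_critical_bounded:
  fixes \<phi> :: "real ^ 'd::finite \<Rightarrow> real"
  assumes \<phi>: "dyadic_partition \<phi>" and u: "typical_blocks \<phi> u" and p: "1 \<le> p" "p < \<infinity>"
  shows "besov_norm \<phi> (- real CARD('d) / 2) p \<infinity> u < \<infinity>"
proof -
  let ?w = "\<lambda>j. 2 powr (- real CARD('d) / 2 * real j)"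
  obtain C where C: "C \<ge> 0" "eventually (\<lambda>j. enn2real (Lp_norm p (lp_block \<phi> j u)) \<le> C * block_sd \<phi> j) sequentially"
    using block_Lp_upper[OF assms] by blast
  obtain b where b: "eventually (\<lambda>j. ?w j * block_sd \<phi> j \<le> b) sequentially"
    using block_sd_bounds[OF \<phi>] by (auto elim!: eventually_mono simp: eventually_conj_iff)
  have "eventually (\<lambda>j. besov_terms \<phi> (- real CARD('d) / 2) p u j \<le> C * b) sequentially"
    using C(2) b
  proof eventually_elim
    case (elim j)
    have "?w j * enn2real (Lp_norm p (lp_block \<phi> j u)) \<le> ?w j * (C * block_sd \<phi> j)"
      using elim(1) by (intro mult_left_mono) auto
    also have "\<dots> = C * (?w j * block_sd \<phi> j)" by simp
    also have "\<dots> \<le> C * b" using elim(2) C(1) by (intro mult_left_mono)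
    finally show ?case by (simp add: besov_terms_def)
  qed
  then show ?thesis by (rule besov_norm_finite_if_bounded[OF p(1)])
qed

text \<open>
  A choice of the constant is fixed by a name because the theorem asks for a lower bound that is the
  same for all realizations of white noise; it depends on the cutoff only.
\<close>

definition besov_lower_const :: "(real ^ 'd::finite \<Rightarrow> real) \<Rightarrow> real" where
  "besov_lower_const \<phi> = (SOME a. 0 < a \<and> eventually (\<lambda>j. a \<le> 2 powr (- real CARD('d) / 2 * real j) * block_sd \<phi> j) sequentially)"

lemma besov_lower_const_bounds:
  fixes \<phi> :: "real ^ 'd::finite \<Rightarrow> real"
  assumes "dyadic_partition \<phi>"
  shows "0 < besov_lower_const \<phi>"
    and "eventually (\<lambda>j. besov_lower_const \<phi> \<le> 2 powr (- real CARD('d) / 2 * real j) * block_sd \<phi> j) sequentially"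
proof -
  have "\<exists>a. 0 < a \<and> eventually (\<lambda>j. a \<le> 2 powr (- real CARD('d) / 2 * real j) * block_sd \<phi> j) sequentially"
    using block_sd_bounds[OF assms] by (auto simp: eventually_conj_iff)
  from someI_ex[OF this] show "0 < besov_lower_const \<phi>"
    and "eventually (\<lambda>j. besov_lower_const \<phi> \<le> 2 powr (- real CARD('d) / 2 * real j) * block_sd \<phi> j) sequentially"
    unfolding besov_lower_const_def by blast+
qed

lemma weighted_block_lower:
  fixes \<phi> :: "real ^ 'd::finite \<Rightarrow> real"
  assumes \<phi>: "dyadic_partition \<phi>" and c: "0 < c"
    and ev: "eventually (\<lambda>j. c * block_sd \<phi> j \<le> x j) sequentially"
  shows "eventually (\<lambda>j. besov_lower_const \<phi> * c \<le> 2 powr (- real CARD('d) / 2 * real j) * x j) sequentially"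
  using ev besov_lower_const_bounds(2)[OF \<phi>]
proof eventually_elim
  case (elim j)
  let ?w = "2 powr (- real CARD('d) / 2 * real j)"
  have "besov_lower_const \<phi> * c \<le> ?w * block_sd \<phi> j * c"
    using elim(2) c by (intro mult_right_mono) auto
  also have "\<dots> = ?w * (c * block_sd \<phi> j)" by simp
  also have "\<dots> \<le> ?w * x j" using elim(1) by (intro mult_left_mono) auto
  finally show ?case .
qed

lemma typical_besov_critical_lower:
  fixes \<phi> :: "real ^ 'd::finite \<Rightarrow> real"
  assumes \<phi>: "dyadic_partition \<phi>" and u: "typical_blocks \<phi> u" and p: "1 \<le> p" "p < \<infinity>"
  shows "ennreal (besov_lower_const \<phi> * Lp_lower_const CARD('d) (enn2real p))
    \<le> besov_norm \<phi> (- real CARD('d) / 2) p \<infinity> u"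
proof -
  have "eventually (\<lambda>j. besov_lower_const \<phi> * Lp_lower_const CARD('d) (enn2real p)
      \<le> besov_terms \<phi> (- real CARD('d) / 2) p u j) sequentially"
    unfolding besov_terms_def
    by (rule weighted_block_lower[OF \<phi> Lp_lower_const_pos block_Lp_lower[OF assms]])
  then obtain j where "besov_lower_const \<phi> * Lp_lower_const CARD('d) (enn2real p)
      \<le> besov_terms \<phi> (- real CARD('d) / 2) p u j"
    using eventually_happens'[OF sequentially_bot] by blast
  then show ?thesis
    unfolding besov_norm_infinity[OF p(1)] by (intro SUP_upper2[of j] ennreal_leI) auto
qed

lemma typical_besov_subcritical:
  fixes \<phi> :: "real ^ 'd::finite \<Rightarrow> real"
  assumes \<phi>: "dyadic_partition \<phi>" and u: "typical_blocks \<phi> u" and p: "1 \<le> p" and q: "1 \<le> q"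
    and s: "s < - real CARD('d) / 2"
  shows "besov_norm \<phi> s p q u < \<infinity>"
proof -
  let ?w = "\<lambda>j. 2 powr (- real CARD('d) / 2 * real j)"
  \<comment> \<open>Half of the smoothness to spare is given up for the sup bound; the other half makes the series
    geometric.\<close>
  define \<epsilon> where "\<epsilon> = - (s + real CARD('d) / 2) / 2"
  have \<epsilon>: "0 < \<epsilon>" using s by (simp add: \<epsilon>_def)
  obtain C where C: "C \<ge> 0" "eventually (\<lambda>j. enn2real (Lp_norm p (lp_block \<phi> j u))
      \<le> C * 2 powr (\<epsilon> * real j) * block_sd \<phi> j) sequentially"
    using block_sup_upper[OF \<phi> u p \<epsilon>] by blast
  obtain b where b: "0 < b" "eventually (\<lambda>j. ?w j * block_sd \<phi> j \<le> b) sequentially"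
    using block_sd_bounds[OF \<phi>] by (auto simp: eventually_conj_iff)
  show ?thesis
  proof (rule besov_norm_finite_if_geometric[OF p q, of "2 powr - \<epsilon>" "C * b"])
    show "2 powr - \<epsilon> < 1" using \<epsilon> by (simp add: powr_less_one)
    show "eventually (\<lambda>j. besov_terms \<phi> s p u j \<le> C * b * (2 powr - \<epsilon>) ^ j) sequentially"
      using C(2) b(2)
    proof eventually_elim
      case (elim j)
      have e: "2 powr ((s + real CARD('d) / 2) * real j) * 2 powr (\<epsilon> * real j) = (2 powr - \<epsilon>) ^ j"
      proof -
        have "s + real CARD('d) / 2 = - 2 * \<epsilon>" by (simp add: \<epsilon>_def)
        then show ?thesis
          unfolding powr_add[symmetric] by (simp add: powr_powr algebra_simps flip: powr_realpow)
      qed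
      have "besov_terms \<phi> s p u j \<le> 2 powr ((s + real CARD('d) / 2) * real j)
          * (?w j * (C * 2 powr (\<epsilon> * real j) * block_sd \<phi> j))"
        unfolding besov_terms_shift[of \<phi> s] using elim(1) by (intro mult_left_mono) auto
      also have "\<dots> = (2 powr ((s + real CARD('d) / 2) * real j) * 2 powr (\<epsilon> * real j)) * (C * (?w j * block_sd \<phi> j))"
        by (simp only: mult_ac)
      also have "\<dots> \<le> (2 powr - \<epsilon>) ^ j * (C * b)"
        unfolding e using elim(2) C(1) by (intro mult_left_mono) auto
      finally show ?case by (simp add: mult_ac)
    qed
  qed (use C(1) b(1) in auto)
qed

lemma typical_besov_critical_infinite:
  fixes \<phi> :: "real ^ 'd::finite \<Rightarrow> real"
  assumes \<phi>: "dyadic_partition \<phi>" and u: "typical_blocks \<phi> u" and p: "1 \<le> p" and q: "1 \<le> q" "q < \<infinity>"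
  shows "\<not> besov_norm \<phi> (- real CARD('d) / 2) p q u < \<infinity>"
proof -
  obtain c where c: "0 < c" "eventually (\<lambda>j. c * block_sd \<phi> j \<le> enn2real (Lp_norm p (lp_block \<phi> j u))) sequentially"
    using block_Lp_lower_all[OF \<phi> u p] by blast
  show ?thesis
    by (rule besov_norm_infinite_if_lower[OF p q _ weighted_block_lower[OF \<phi> c, folded besov_terms_def]])
      (use besov_lower_const_bounds(1)[OF \<phi>] c(1) in simp)
qed

lemma typical_besov_supercritical:
  fixes \<phi> :: "real ^ 'd::finite \<Rightarrow> real"
  assumes \<phi>: "dyadic_partition \<phi>" and u: "typical_blocks \<phi> u" and p: "1 \<le> p" and q: "1 \<le> q"
    and s: "- real CARD('d) / 2 < s"
  shows "\<not> besov_norm \<phi> s p q u < \<infinity>"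
proof -
  obtain c where c: "0 < c" "eventually (\<lambda>j. c * block_sd \<phi> j \<le> enn2real (Lp_norm p (lp_block \<phi> j u))) sequentially"
    using block_Lp_lower_all[OF \<phi> u p] by blast
  let ?r = "s + real CARD('d) / 2" and ?c = "besov_lower_const \<phi> * c"
  have r: "0 < ?r" using s by simp
  have c': "0 < ?c" using besov_lower_const_bounds(1)[OF \<phi>] c(1) by simp
  have "filterlim (\<lambda>j. 2 powr (t * real j) * b) at_top sequentially" if "0 < t" "0 < b" for t b :: real
    using that by real_asymp
  from this[OF r c'] have "filterlim (\<lambda>j. 2 powr (?r * real j) * ?c) at_top sequentially" .
  moreover have "eventually (\<lambda>j. 2 powr (?r * real j) * ?c \<le> besov_terms \<phi> s p u j) sequentially"
    using weighted_block_lower[OF \<phi> c]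
    by eventually_elim (auto simp: besov_terms_shift[of \<phi> s] intro!: mult_left_mono)
  ultimately have "filterlim (besov_terms \<phi> s p u) at_top sequentially"
    by (rule filterlim_at_top_mono)
  then show ?thesis by (rule besov_norm_infinite_if_unbounded[OF p q])
qed

lemma typical_besov_sup_infinite:
  fixes \<phi> :: "real ^ 'd::finite \<Rightarrow> real"
  assumes \<phi>: "dyadic_partition \<phi>" and u: "typical_blocks \<phi> u"
  shows "\<not> besov_norm \<phi> (- real CARD('d) / 2) \<infinity> \<infinity> u < \<infinity>"
proof (rule besov_norm_infinite_if_unbounded)
  let ?a = "besov_lower_const \<phi>"
  have a: "0 < ?a" by (rule besov_lower_const_bounds(1)[OF \<phi>])
  show "filterlim (besov_terms \<phi> (- real CARD('d) / 2) \<infinity> u) at_top sequentially"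
  proof (rule filterlim_at_top_gt[THEN iffD2, of 0], intro allI impI)
    fix Z :: real assume "0 < Z"
    then have Z: "0 < Z / ?a" using a by simp
    show "eventually (\<lambda>j. Z \<le> besov_terms \<phi> (- real CARD('d) / 2) \<infinity> u j) sequentially"
      using weighted_block_lower[OF \<phi> Z block_Linf_growth[OF \<phi> u Z]] a
      by (simp add: besov_terms_def)
  qed
qed auto

section \<open>Measurability, and the theorem\<close>

lemma borel_measurable_ennpowr [measurable]: "(\<lambda>x. ennpowr x a) \<in> borel_measurable borel"
  unfolding ennpowr_def by measurable

text \<open>
  For \<open>p = \<infinity>\<close>, the essential supremum is at most \<open>c\<close> iff the set where the function exceeds \<open>c\<close> has measure \<open>0\<close>, and
  the measure of this set is measurable in \<open>\<omega>\<close> by Tonelli.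
\<close>

lemma Lp_norm_lp_block_measurable:
  fixes W :: "'w \<Rightarrow> (real ^ 'd::finite \<Rightarrow> complex) \<Rightarrow> complex"
  assumes W: "white_noise M W"
  shows "(\<lambda>\<omega>. Lp_norm p (lp_block \<phi> j (W \<omega>))) \<in> borel_measurable M"
proof -
  interpret T: finite_measure "torus_measure :: (real ^ 'd) measure" by (rule finite_torus_measure)
  have [measurable]: "(\<lambda>(\<omega>, x). lp_block \<phi> j (W \<omega>) x) \<in> borel_measurable (M \<Otimes>\<^sub>M torus_measure)"
    unfolding lp_block_eq_noise_series by (rule noise_series_measurable[OF W])
  have [measurable]: "lp_block \<phi> j u \<in> borel_measurable torus_measure" for u
    by (intro borel_measurable_torus_continuous continuous_on_lp_block)
  show ?thesis
  proof (cases "p = \<infinity>")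
    case False
    then show ?thesis unfolding Lp_norm_def by simp
  next
    case True
    let ?N = "\<lambda>\<omega>. esssup torus_measure (\<lambda>x. ennreal (norm (lp_block \<phi> j (W \<omega>) x)))"
    have "?N \<in> borel_measurable M"
    proof (rule borel_measurableI_le)
      fix c :: ennreal
      let ?h = "\<lambda>\<omega>. \<integral>\<^sup>+x. indicator {c<..} (ennreal (norm (lp_block \<phi> j (W \<omega>) x))) \<partial>torus_measure"
      have "?N \<omega> \<le> c \<longleftrightarrow> (AE x in torus_measure. ennreal (norm (lp_block \<phi> j (W \<omega>) x)) \<le> c)" for \<omega>
      proof
        assume "?N \<omega> \<le> c"
        then show "AE x in torus_measure. ennreal (norm (lp_block \<phi> j (W \<omega>) x)) \<le> c"
          using esssup_AE[of "\<lambda>x. ennreal (norm (lp_block \<phi> j (W \<omega>) x))" torus_measure]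
          by (auto elim!: eventually_mono)
      qed (intro esssup_I, measurable)
      also have "\<dots> \<omega> \<longleftrightarrow> ?h \<omega> = 0" for \<omega>
        by (subst nn_integral_0_iff_AE) (auto simp: indicator_eq_0_iff not_less)
      finally have "{\<omega> \<in> space M. ?N \<omega> \<le> c} = {\<omega> \<in> space M. ?h \<omega> = 0}" by simp
      also have "\<dots> \<in> sets M" by measurable
      finally show "{\<omega> \<in> space M. ?N \<omega> \<le> c} \<in> sets M" .
    qed
    then show ?thesis unfolding Lp_norm_def using True by simp
  qed
qed

lemma besov_norm_measurable:
  fixes W :: "'w \<Rightarrow> (real ^ 'd::finite \<Rightarrow> complex) \<Rightarrow> complex"
  assumes W: "white_noise M W"
  shows "(\<lambda>\<omega>. besov_norm \<phi> s p q (W \<omega>)) \<in> borel_measurable M"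
proof -
  note [measurable] = Lp_norm_lp_block_measurable[OF W]
  show ?thesis unfolding besov_norm_def by (cases "q = \<infinity>") simp_all
qed

theorem theorem3p4:
  fixes \<phi> :: "real ^ 'd::finite \<Rightarrow> real"
  assumes "dyadic_partition \<phi>"
  shows "\<exists>c :: ennreal \<Rightarrow> real.
    (\<forall>p. 2 \<le> p \<and> p < \<infinity> \<longrightarrow> 0 < c p) \<and>
    (\<forall>(M :: 'w measure) (W :: 'w \<Rightarrow> (real ^ 'd \<Rightarrow> complex) \<Rightarrow> complex). white_noise M W \<longrightarrow>
      (\<forall>p. 1 \<le> p \<and> p < \<infinity> \<longrightarrow>
         has_prob M (\<lambda>\<omega>. W \<omega> \<in> besov \<phi> (- real CARD('d) / 2) p \<infinity>) 1) \<and>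
      (\<forall>p. 2 \<le> p \<and> p < \<infinity> \<longrightarrow>
         has_prob M (\<lambda>\<omega>. ennreal (c p) \<le> besov_norm \<phi> (- real CARD('d) / 2) p \<infinity> (W \<omega>)) 1) \<and>
      (\<forall>p q s. 1 \<le> p \<and> 1 \<le> q \<and> s < - real CARD('d) / 2 \<longrightarrow>
         has_prob M (\<lambda>\<omega>. W \<omega> \<in> besov \<phi> s p q) 1) \<and>
      (\<forall>p q. 1 \<le> p \<and> 1 \<le> q \<and> q < \<infinity> \<longrightarrow>
         has_prob M (\<lambda>\<omega>. W \<omega> \<in> besov \<phi> (- real CARD('d) / 2) p q) 0) \<and>
      (\<forall>p q s. 1 \<le> p \<and> 1 \<le> q \<and> - real CARD('d) / 2 < s \<longrightarrow>
         has_prob M (\<lambda>\<omega>. W \<omega> \<in> besov \<phi> s p q) 0) \<and>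
      has_prob M (\<lambda>\<omega>. W \<omega> \<in> besov \<phi> (- real CARD('d) / 2) \<infinity> \<infinity>) 0)"
proof -
  note \<phi> = assms
  define c where "c p = besov_lower_const \<phi> * Lp_lower_const CARD('d) (enn2real p)" for p
  have "0 < c p" for p
    unfolding c_def by (intro mult_pos_pos besov_lower_const_bounds(1)[OF \<phi>] Lp_lower_const_pos)
  moreover
  {
    fix M :: "'w measure" and W :: "'w \<Rightarrow> (real ^ 'd \<Rightarrow> complex) \<Rightarrow> complex"
    assume W: "white_noise M W"
    interpret prob_space M using W by (rule white_noise_prob_space)
    note [measurable] = besov_norm_measurable[OF W]
    have typical: "AE \<omega> in M. typical_blocks \<phi> (W \<omega>)" by (rule typical_blocks_AE[OF W \<phi>])
    have prob_1: "has_prob M P 1"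
      if "{\<omega> \<in> space M. P \<omega>} \<in> events" "\<And>\<omega>. typical_blocks \<phi> (W \<omega>) \<Longrightarrow> \<omega> \<in> space M \<Longrightarrow> P \<omega>" for P
    proof -
      have "AE \<omega> in M. P \<omega>" using typical AE_space by eventually_elim (rule that(2))
      then show ?thesis using prob_Collect_eq_1[OF that(1)] that(1) by (simp add: has_prob_def)
    qed
    have prob_0: "has_prob M P 0"
      if "{\<omega> \<in> space M. P \<omega>} \<in> events" "\<And>\<omega>. typical_blocks \<phi> (W \<omega>) \<Longrightarrow> \<not> P \<omega>" for P
    proof -
      have "AE \<omega> in M. \<not> P \<omega>" using typical by eventually_elim (rule that(2))
      then show ?thesis using prob_Collect_eq_0[OF that(1)] that(1) by (simp add: has_prob_def)
    qed
    have besov_event: "{\<omega> \<in> space M. W \<omega> \<in> besov \<phi> s p q} \<in> events" for s p q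
    proof -
      have "{\<omega> \<in> space M. W \<omega> \<in> besov \<phi> s p q} = {\<omega> \<in> space M. besov_norm \<phi> s p q (W \<omega>) < \<infinity>}"
        using white_noise_distributions[OF W] by (auto simp: besov_def)
      then show ?thesis by simp
    qed
    have in_besov: "has_prob M (\<lambda>\<omega>. W \<omega> \<in> besov \<phi> s p q) 1"
      if "\<And>u. typical_blocks \<phi> u \<Longrightarrow> besov_norm \<phi> s p q u < \<infinity>" for s p q
      using that white_noise_distributions[OF W] by (intro prob_1 besov_event) (auto simp: besov_def)
    have notin_besov: "has_prob M (\<lambda>\<omega>. W \<omega> \<in> besov \<phi> s p q) 0"
      if "\<And>u. typical_blocks \<phi> u \<Longrightarrow> \<not> besov_norm \<phi> s p q u < \<infinity>" for s p q
      using that by (intro prob_0 besov_event) (auto simp: besov_def)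
    have "has_prob M (\<lambda>\<omega>. W \<omega> \<in> besov \<phi> (- real CARD('d) / 2) p \<infinity>) 1" if "1 \<le> p" "p < \<infinity>" for p
      by (rule in_besov) (rule typical_besov_critical_bounded[OF \<phi> _ that])
    moreover have "has_prob M (\<lambda>\<omega>. ennreal (c p) \<le> besov_norm \<phi> (- real CARD('d) / 2) p \<infinity> (W \<omega>)) 1"
      if "2 \<le> p" "p < \<infinity>" for p
    proof (rule prob_1)
      have "(1 :: ennreal) \<le> 2" by simp
      then have "1 \<le> p" using that(1) by (rule order_trans)
      then show "ennreal (c p) \<le> besov_norm \<phi> (- real CARD('d) / 2) p \<infinity> (W \<omega>)"
        if "typical_blocks \<phi> (W \<omega>)" for \<omega>
        unfolding c_def using \<phi> that \<open>p < \<infinity>\<close> by (intro typical_besov_critical_lower)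
    qed measurable
    moreover have "has_prob M (\<lambda>\<omega>. W \<omega> \<in> besov \<phi> s p q) 1"
      if "1 \<le> p" "1 \<le> q" "s < - real CARD('d) / 2" for p q s
      by (rule in_besov) (rule typical_besov_subcritical[OF \<phi> _ that])
    moreover have "has_prob M (\<lambda>\<omega>. W \<omega> \<in> besov \<phi> (- real CARD('d) / 2) p q) 0"
      if "1 \<le> p" "1 \<le> q" "q < \<infinity>" for p q
      by (rule notin_besov) (rule typical_besov_critical_infinite[OF \<phi> _ that])
    moreover have "has_prob M (\<lambda>\<omega>. W \<omega> \<in> besov \<phi> s p q) 0"
      if "1 \<le> p" "1 \<le> q" "- real CARD('d) / 2 < s" for p q s
      by (rule notin_besov) (rule typical_besov_supercritical[OF \<phi> _ that])
    moreover have "has_prob M (\<lambda>\<omega>. W \<omega> \<in> besov \<phi> (- real CARD('d) / 2) \<infinity> \<infinity>) 0"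
      by (rule notin_besov) (rule typical_besov_sup_infinite[OF \<phi>])
    ultimately have "(\<forall>p. 1 \<le> p \<and> p < \<infinity> \<longrightarrow>
         has_prob M (\<lambda>\<omega>. W \<omega> \<in> besov \<phi> (- real CARD('d) / 2) p \<infinity>) 1) \<and>
      (\<forall>p. 2 \<le> p \<and> p < \<infinity> \<longrightarrow>
         has_prob M (\<lambda>\<omega>. ennreal (c p) \<le> besov_norm \<phi> (- real CARD('d) / 2) p \<infinity> (W \<omega>)) 1) \<and>
      (\<forall>p q s. 1 \<le> p \<and> 1 \<le> q \<and> s < - real CARD('d) / 2 \<longrightarrow>
         has_prob M (\<lambda>\<omega>. W \<omega> \<in> besov \<phi> s p q) 1) \<and>
      (\<forall>p q. 1 \<le> p \<and> 1 \<le> q \<and> q < \<infinity> \<longrightarrow>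
         has_prob M (\<lambda>\<omega>. W \<omega> \<in> besov \<phi> (- real CARD('d) / 2) p q) 0) \<and>
      (\<forall>p q s. 1 \<le> p \<and> 1 \<le> q \<and> - real CARD('d) / 2 < s \<longrightarrow>
         has_prob M (\<lambda>\<omega>. W \<omega> \<in> besov \<phi> s p q) 0) \<and>
      has_prob M (\<lambda>\<omega>. W \<omega> \<in> besov \<phi> (- real CARD('d) / 2) \<infinity> \<infinity>) 0"
      by blast
  }
  ultimately show ?thesis by (intro exI[of _ c]) blast
qed

end
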